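(* Let $\mathfrak g$ be a finite-dimensional real nilpotent Lie algebra with $\dim\mathfrak g=m$ and with a fixed Jordan-Hölder sequence $\mathfrak F_\bullet:\ \{0\}=\mathfrak F_0\subseteq\mathfrak F_1\subseteq\cdots\subseteq\mathfrak F_m=\mathfrak g$. Let $(V_1,\dots,V_m)\in \mathrm{JH}_{\mathfrak F_\bullet}(\mathfrak g)$ and $e\subseteq\{1,\dots,m\}$ be fixed, and define $\mathfrak g_e:=\mathrm{span}\{V_j\mid j\in e\}$. Then for every $\mathfrak h\in \mathrm{Gr}^{\mathrm{alg}}_{\mathfrak F_\bullet,e}(\mathfrak g)$ the Baker-Campbell-Hausdorff multiplication defines a polynomial diffeomorphism $\mathfrak g_e\times\mathfrak h\to\mathfrak g$, $(X,Y)\mapsto X\cdot Y$. Moreover, there exist a real analytic map $\beta=(Y_1(\cdot),\dots,Y_m(\cdot))\colon \mathrm{Gr}_{\mathfrak g_e}(\mathfrak g)\to\mathfrak g^m$ and a polynomial map $p=(p_1,\dots,p_m)\colon\mathfrak g\times \mathrm{JH}_{\mathfrak F_\bullet}(\mathfrak g)\to\mathbb R^m$ such that: (i) For every $\mathfrak h\in \mathrm{Gr}^{\mathrm{alg}}_{\mathfrak F_\bullet,e}(\mathfrak g)$ one has $\beta(\mathfrak h)=(Y_1(\mathfrak h),\dots,Y_m(\mathfrak h))\in \mathrm{JH}_{\mathfrak F_\bullet}(\mathfrak g)$. (ii) The formula $$\Pi(Y,\mathfrak h)=\sum_{j\in e}p_j(Y,\beta(\mathfrak h))\,Y_j(\mathfrak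 h)$$ defines a function $\Pi\colon\mathfrak g\times \mathrm{Gr}^{\mathrm{alg}}_{\mathfrak F_\bullet,e}(\mathfrak g)\to\mathfrak g_e$ with the property that $$X\in\Pi(X,\mathfrak h)\cdot\mathfrak h\quad\text{for all }X\in\mathfrak g\text{ and all }\mathfrak h\in \mathrm{Gr}^{\mathrm{alg}}_{\mathfrak F_\bullet,e}(\mathfrak g),$$ and $\Pi$ is the unique function $\mathfrak g\times \mathrm{Gr}^{\mathrm{alg}}_{\mathfrak F_\bullet,e}(\mathfrak g)\to\mathfrak g_e$ with this property.
   Context: Baker-Campbell-Hausdorff multiplication: for a finite-dimensional real nilpotent Lie algebra $\mathfrak g$, $X\cdot Y$ denotes the sum of the Baker-Campbell-Hausdorff series $X+Y+\frac12[X,Y]+\cdots$, which has only finitely many nonzero terms, so that $(X,Y)\mapsto X\cdot Y$ is a polynomial map $\mathfrak g\times\mathfrak g\to\mathfrak g$; it is a group structure on $\mathfrak g$ (the nilpotent Lie group $G=(\mathfrak g,\cdot)$). For $Z\in\mathfrak g$ and a subset $\mathfrak h\subseteq\mathfrak g$, $Z\cdot\mathfrak h:=\{Z\cdot H\mid H\in\mathfrak h\}$. Jordan-Hölder sequence: linear subspaces $\mathfrak F_0\subset\mathfrak F_1\subset\cdots\subset\mathfrak F_m=\mathfrak g$ with $\dim\mathfrak F_k=k$ and $[\mathfrak g,\mathfrak F_k]\subseteq\mathfrak F_{k-1}$ for $k=1,\dots,m$. Define $$\mathrm{JH}_{\mathfrak F_\bullet}(\mathfrak g):=(\mathfrak F_1\setminus\mathfrak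 F_0)\times(\mathfrak F_2\setminus\mathfrak F_1)\times\cdots\times(\mathfrak F_m\setminus\mathfrak F_{m-1})\subseteq\mathfrak g^m,$$ that is, the set of all bases $(X_1,\dots,X_m)$ of $\mathfrak g$ with $\mathfrak F_k=\mathrm{span}\{X_1,\dots,X_k\}$ for all $k$. Grassmann manifold: $\mathrm{Gr}(\mathfrak g)$ is the set of all linear subspaces of $\mathfrak g$. Fixing a scalar product on $\mathfrak g$, it is given the real analytic manifold structure for which the bijection sending a subspace $\mathfrak W$ to the orthogonal projection $P_{\mathfrak W}$ onto it, from $\mathrm{Gr}(\mathfrak g)$ onto the real analytic submanifold $\{P\mid P=P^2=P^*\}$ of the space of linear operators on $\mathfrak g$, is a real analytic diffeomorphism. For a linear subspace $\mathfrak U_0\subseteq\mathfrak g$, $\mathrm{Gr}_{\mathfrak U_0}(\mathfrak g):=\{\mathfrak W\in \mathrm{Gr}(\mathfrak g)\mid \mathfrak U_0\dotplus\mathfrak W=\mathfrak g\}$ (direct sum), which is an open subset of $\mathrm{Gr}(\mathfrak g)$. Jump indices and Schubert cells: for $\mathfrak W\in \mathrm{Gr}(\mathfrak g)$, $\mathrm{jump}_{\mathfrak F_\bullet}(\mathfrak W):=\{j\in\{1,\dots,m\}\mid\mathfrak F_j\not\subseteq\mathfrak W+\mathfrak F_{j-1}\}$. $\mathrm{Gr}^{\mathrm{alg}}_{\mathfrak F_\bullet,e}(\mathfrak g)$ is the set of all Lie subalgebras $\mathfrak h$ of $\mathfrak g$ with $\mathrm{jump}_{\mathfrak F_\bullet}(\mathfrak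 h)=e$ (such $\mathfrak h$ belong to $\mathrm{Gr}_{\mathfrak g_e}(\mathfrak g)$). A polynomial diffeomorphism is a bijective polynomial map between finite-dimensional real vector spaces whose inverse is also polynomial. A polynomial map on $\mathfrak g\times \mathrm{JH}_{\mathfrak F_\bullet}(\mathfrak g)$ is the restriction of a polynomial map on $\mathfrak g\times\mathfrak g^m$. *)

theory Defs
  imports "HOL-Analysis.Analysis"
begin

definition lie_bracket :: "('a::real_vector \<Rightarrow> 'a \<Rightarrow> 'a) \<Rightarrow> bool" where
  "lie_bracket br \<longleftrightarrow> bilinear br \<and> (\<forall>x. br x x = 0) \<and>
     (\<forall>x y z. br x (br y z) + br y (br z x) + br z (br x y) = 0)"

primrec lower_central :: "('a::real_vector \<Rightarrow> 'a \<Rightarrow> 'a) \<Rightarrow> nat \<Rightarrow> 'a set" where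
  "lower_central br 0 = UNIV"
| "lower_central br (Suc n) = span {br x y | x y. y \<in> lower_central br n}"

definition nilpotent_lie_algebra :: "('a::real_vector \<Rightarrow> 'a \<Rightarrow> 'a) \<Rightarrow> bool" where
  "nilpotent_lie_algebra br \<longleftrightarrow> lie_bracket br \<and> (\<exists>n. lower_central br n = {0})"

definition lie_subalgebra :: "('a::real_vector \<Rightarrow> 'a \<Rightarrow> 'a) \<Rightarrow> 'a set \<Rightarrow> bool" where
  "lie_subalgebra br h \<longleftrightarrow> subspace h \<and> (\<forall>x\<in>h. \<forall>y\<in>h. br x y \<in> h)"


text \<open>The Baker-Campbell-Hausdorff series in Dynkin's explicit form. A list
  \<open>[(r\<^sub>1,s\<^sub>1),\<dots>,(r\<^sub>k,s\<^sub>k)]\<close> with \<open>r\<^sub>i + s\<^sub>i > 0\<close> and total degree \<open>n = \<Sum>(r\<^sub>i + s\<^sub>i)\<close> contributes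
  \<open>(-1)\<^bsup>k-1\<^esup> / (k n \<Prod> r\<^sub>i! s\<^sub>i!)\<close> times the right-nested bracket of the word
  \<open>X\<^bsup>r\<^sub>1\<^esup> Y\<^bsup>s\<^sub>1\<^esup> \<dots> X\<^bsup>r\<^sub>k\<^esup> Y\<^bsup>s\<^sub>k\<^esup>\<close>.\<close>

fun nested_bracket :: "('a::zero \<Rightarrow> 'a \<Rightarrow> 'a) \<Rightarrow> 'a list \<Rightarrow> 'a" where
  "nested_bracket br [] = 0"
| "nested_bracket br [x] = x"
| "nested_bracket br (x # y # zs) = br x (nested_bracket br (y # zs))"

definition dynkin_index :: "nat \<Rightarrow> (nat \<times> nat) list set" where
  "dynkin_index n = {ps. ps \<noteq> [] \<and> (\<forall>(r, s) \<in> set ps. r + s > 0) \<and> (\<Sum>(r, s)\<leftarrow>ps. r + s) = n}"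

definition dynkin_word :: "'a \<Rightarrow> 'a \<Rightarrow> (nat \<times> nat) list \<Rightarrow> 'a list" where
  "dynkin_word X Y ps = concat (map (\<lambda>(r, s). replicate r X @ replicate s Y) ps)"

definition dynkin_coeff :: "(nat \<times> nat) list \<Rightarrow> real" where
  "dynkin_coeff ps = (- 1) ^ (length ps - 1) /
     (real (length ps) * real (\<Sum>(r, s)\<leftarrow>ps. r + s) * (\<Prod>(r, s)\<leftarrow>ps. fact r * fact s))"

definition bch_component :: "('a::real_vector \<Rightarrow> 'a \<Rightarrow> 'a) \<Rightarrow> nat \<Rightarrow> 'a \<Rightarrow> 'a \<Rightarrow> 'a" where
  "bch_component br n X Y =
     (\<Sum>ps\<in>dynkin_index n. dynkin_coeff ps *\<^sub>R nested_bracket br (dynkin_word X Y ps))"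

definition bch :: "('a::real_normed_vector \<Rightarrow> 'a \<Rightarrow> 'a) \<Rightarrow> 'a \<Rightarrow> 'a \<Rightarrow> 'a" where
  "bch br X Y = (\<Sum>n. bch_component br n X Y)"

lemma finite_dynkin_index: "finite (dynkin_index n)"
proof -
  have len: "length ps \<le> (\<Sum>(r, s)\<leftarrow>ps. r + s)"
    if "\<forall>(r, s) \<in> set ps. r + s > 0" for ps :: "(nat \<times> nat) list"
    using that by (induction ps) auto
  have mem: "set ps \<subseteq> {..\<Sum>(r, s)\<leftarrow>ps. r + s} \<times> {..\<Sum>(r, s)\<leftarrow>ps. r + s}"
    for ps :: "(nat \<times> nat) list"
    by (induction ps) fastforce+
  have "dynkin_index n \<subseteq> {ps. set ps \<subseteq> {..n} \<times> {..n} \<and> length ps \<le> n}"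
    using len mem unfolding dynkin_index_def by blast
  then show ?thesis
    by (rule finite_subset) (intro finite_lists_length_le, simp)
qed

lemma bch_finite_sum:
  assumes "nilpotent_lie_algebra br"
  shows "\<exists>N. \<forall>X Y. bch br X Y = (\<Sum>n\<le>N. bch_component br n X Y)"
proof -
  from assms obtain N where N: "lower_central br N = {0}" and bil: "bilinear br"
    by (auto simp: nilpotent_lie_algebra_def lie_bracket_def)
  have lcs: "nested_bracket br (x # xs) \<in> lower_central br (length xs)" for x xs
  proof (induction xs arbitrary: x)
    case (Cons y ys)
    then show ?case by (auto intro: span_base)
  qed simp
  have zero: "lower_central br (N + k) = {0}" for k
  proof (induction k)
    case (Suc k)
    have "{br x y | x y. y \<in> lower_central br (N + k)} = {0}"
      using Suc bilinear_rzero[OF bil] by auto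
    then show ?case by simp
  qed (use N in simp)
  have vanish: "nested_bracket br xs = 0" if "length xs > N" for xs
  proof (cases xs)
    case (Cons x ys)
    with that obtain k where "length ys = N + k"
      by (metis length_Cons less_Suc_eq_le le_iff_add)
    then show ?thesis using lcs[of x ys] zero[of k] Cons by simp
  qed simp
  have len: "length (dynkin_word X Y ps) = (\<Sum>(r, s)\<leftarrow>ps. r + s)" for X Y :: 'a and ps
    unfolding dynkin_word_def by (induction ps) auto
  have "bch_component br n X Y = 0" if "n > N" for n X Y
    unfolding bch_component_def
    by (intro sum.neutral) (use that len in \<open>auto simp: dynkin_index_def intro!: vanish\<close>)
  then have "bch br X Y = (\<Sum>n\<le>N. bch_component br n X Y)" for X Y
    unfolding bch_def by (intro suminf_finite) auto
  then show ?thesis by blast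
qed


definition polynomial_map_on ::
    "'a::real_normed_vector set \<Rightarrow> ('a \<Rightarrow> 'b::real_normed_vector) \<Rightarrow> bool" where
  "polynomial_map_on S f \<longleftrightarrow> (\<exists>q. polynomial_function q \<and> (\<forall>x\<in>S. f x = q x))"

text \<open>Intended for linear subspaces \<open>S\<close> and \<open>T\<close>, where the polynomial maps are exactly the
  restrictions of polynomial maps of the ambient space.\<close>

definition polynomial_diffeo ::
    "'a::real_normed_vector set \<Rightarrow> 'b::real_normed_vector set \<Rightarrow> ('a \<Rightarrow> 'b) \<Rightarrow> bool" where
  "polynomial_diffeo S T f \<longleftrightarrow>
     bij_betw f S T \<and> polynomial_map_on S f \<and> polynomial_map_on T (inv_into S f)"


text \<open>The index set \<open>{1,\<dots>,m}\<close> of an \<open>m\<close>-tuple is a finite linear order \<open>'m\<close> with \<open>m\<close> elements;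
  \<open>pos\<close> is its order isomorphism onto \<open>{1,\<dots>,m}\<close>.\<close>

definition pos :: "'m::{finite,linorder} \<Rightarrow> nat" where
  "pos i = card {..i}"

definition jh_sequence :: "('a::euclidean_space \<Rightarrow> 'a \<Rightarrow> 'a) \<Rightarrow> (nat \<Rightarrow> 'a set) \<Rightarrow> bool" where
  "jh_sequence br F \<longleftrightarrow>
     (\<forall>k\<le>DIM('a). subspace (F k) \<and> dim (F k) = k) \<and>
     (\<forall>k<DIM('a). F k \<subseteq> F (Suc k)) \<and>
     F 0 = {0} \<and> F (DIM('a)) = UNIV \<and>
     (\<forall>k\<in>{1..DIM('a)}. \<forall>x. \<forall>y\<in>F k. br x y \<in> F (k - 1))"

definition JH :: "(nat \<Rightarrow> 'a set) \<Rightarrow> ('a ^ 'm::{finite,linorder}) set" where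
  "JH F = {X. \<forall>i. X $ i \<in> F (pos i) - F (pos i - 1)}"

definition jump :: "(nat \<Rightarrow> 'a::real_vector set) \<Rightarrow> 'a set \<Rightarrow> 'm::{finite,linorder} set" where
  "jump F W = {j. \<not> F (pos j) \<subseteq> W + F (pos j - 1)}"

definition Gr_alg ::
    "('a::real_vector \<Rightarrow> 'a \<Rightarrow> 'a) \<Rightarrow> (nat \<Rightarrow> 'a set) \<Rightarrow> 'm::{finite,linorder} set \<Rightarrow> 'a set set" where
  "Gr_alg br F e = {h. lie_subalgebra br h \<and> jump F h = e}"

definition Gr_compl :: "'a::real_vector set \<Rightarrow> 'a set set" where
  "Gr_compl U = {W. subspace W \<and> U \<inter> W = {0} \<and> U + W = UNIV}"


definition orth_proj :: "'a::euclidean_space set \<Rightarrow> 'a \<Rightarrow>\<^sub>L 'a" where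
  "orth_proj W = (THE P. \<forall>x. blinfun_apply P x \<in> W \<and> (\<forall>w\<in>W. orthogonal (x - blinfun_apply P x) w))"

lemma orth_proj:
  fixes W :: "'a::euclidean_space set"
  assumes W: "subspace W"
  shows "blinfun_apply (orth_proj W) x \<in> W"
    and "w \<in> W \<Longrightarrow> orthogonal (x - blinfun_apply (orth_proj W) x) w"
proof -
  have uniq: "y = z" if "y \<in> W" "z \<in> W" "\<forall>w\<in>W. orthogonal (x - y) w" "\<forall>w\<in>W. orthogonal (x - z) w"
    for x y z :: 'a
  proof -
    have "y - z \<in> W" using that W by (simp add: subspace_diff)
    then have "(x - z) \<bullet> (y - z) - (x - y) \<bullet> (y - z) = 0"
      using that by (simp add: orthogonal_def)
    then have "(y - z) \<bullet> (y - z) = 0"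
      by (simp add: inner_diff_left)
    then show ?thesis by simp
  qed
  have "\<exists>y. y \<in> W \<and> (\<forall>w\<in>W. orthogonal (x - y) w)" for x
  proof -
    obtain y z where "y \<in> span W" "\<And>w. w \<in> span W \<Longrightarrow> orthogonal z w" "x = y + z"
      using orthogonal_subspace_decomp_exists[of W x] by blast
    moreover have "span W = W" using W by (rule span_eq_iff[THEN iffD2])
    ultimately show ?thesis by (intro exI[of _ y]) auto
  qed
  then obtain p where p: "\<And>x. p x \<in> W" "\<And>x w. w \<in> W \<Longrightarrow> orthogonal (x - p x) w"
    by metis
  have "linear p"
  proof (rule linearI)
    fix x y and c :: real
    show "p (x + y) = p x + p y"
    proof (rule uniq[of _ _ "x + y"])
      show "\<forall>w\<in>W. orthogonal (x + y - (p x + p y)) w"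
        using p(2)[of _ x] p(2)[of _ y] by (simp add: orthogonal_def algebra_simps)
    qed (use p W in \<open>auto simp: subspace_add\<close>)
    show "p (c *\<^sub>R x) = c *\<^sub>R p x"
    proof (rule uniq[of _ _ "c *\<^sub>R x"])
      show "\<forall>w\<in>W. orthogonal (c *\<^sub>R x - c *\<^sub>R p x) w"
        using p(2)[of _ x] by (simp add: orthogonal_def flip: scaleR_diff_right)
    qed (use p W in \<open>auto simp: subspace_scale\<close>)
  qed
  then have bl: "blinfun_apply (Blinfun p) = p"
    by (simp add: bounded_linear_Blinfun_apply linear_conv_bounded_linear)
  let ?Q = "\<lambda>P. \<forall>x. blinfun_apply P x \<in> W \<and> (\<forall>w\<in>W. orthogonal (x - blinfun_apply P x) w)"
  have "?Q (orth_proj W)"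
    unfolding orth_proj_def
  proof (rule theI[of ?Q "Blinfun p"])
    show "?Q (Blinfun p)" using bl p by simp
    show "P = Blinfun p" if "?Q P" for P
      by (rule blinfun_eqI, rule uniq) (use that bl p in auto)
  qed
  then show "blinfun_apply (orth_proj W) x \<in> W"
    and "w \<in> W \<Longrightarrow> orthogonal (x - blinfun_apply (orth_proj W) x) w" by auto
qed

text \<open>Real analyticity on finite-dimensional spaces: local expansion
  \<open>f (a + v) = \<Sum>n. P n v\<close> into homogeneous polynomials \<open>P n\<close> of degree \<open>n\<close>, converging normally
  on every closed ball of radius less than \<open>r\<close>.\<close>

definition real_analytic_at :: "('a::real_normed_vector \<Rightarrow> 'b::real_normed_vector) \<Rightarrow> 'a \<Rightarrow> bool" where
  "real_analytic_at f a \<longleftrightarrow> (\<exists>r>0. \<exists>C. \<exists>P :: nat \<Rightarrow> 'a \<Rightarrow> 'b.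
     (\<forall>n. polynomial_function (P n) \<and> (\<forall>t v. P n (t *\<^sub>R v) = t ^ n *\<^sub>R P n v) \<and>
          (\<forall>v. norm (P n v) \<le> C * (norm v / r) ^ n)) \<and>
     (\<forall>v. norm v < r \<longrightarrow> (\<lambda>n. P n v) sums f (a + v)))"

text \<open>Real analyticity of a map on a set \<open>U\<close> of subspaces that is open in the Grassmann manifold.
  The manifold structure is that of the embedded submanifold of orthogonal projections in
  \<open>'a \<Rightarrow>\<^sub>L 'a\<close>; a map on an embedded submanifold is real analytic iff it extends locally to a
  real analytic map on an open subset of the ambient space.\<close>

definition Gr_analytic_on :: "'a::euclidean_space set set \<Rightarrow> ('a set \<Rightarrow> 'b::real_normed_vector) \<Rightarrow> bool" where
  "Gr_analytic_on U f \<longleftrightarrow> (\<forall>W\<in>U. \<exists>S g. open S \<and> orth_proj W \<in> S \<and>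
     (\<forall>P\<in>S. real_analytic_at g P) \<and> (\<forall>W'\<in>U. orth_proj W' \<in> S \<longrightarrow> f W' = g (orth_proj W')))"

end

theory Submission
  imports Defs
begin

text \<open>The flag is lowered by brackets, so \<open>X \<cdot> Y = X + Y + R(X, Y)\<close>, where changing \<open>X\<close> and \<open>Y\<close> by
  elements of \<open>F\<^sub>k\<close> changes \<open>R(X, Y)\<close> by an element of \<open>F\<^sub>k\<^sub>-\<^sub>1\<close>; associativity plays no role. A
  subalgebra \<open>h\<close> with jump set \<open>e\<close> is a complement of \<open>g\<^sub>e\<close> compatible with the flag. Keeping \<open>V\<^sub>j\<close> for
  \<open>j \<in> e\<close> and projecting \<open>V\<^sub>j\<close> for \<open>j \<notin> e\<close> onto \<open>h\<close> along \<open>g\<^sub>e\<close> gives a basis \<open>\<beta>(h)\<close> with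
  \<open>\<beta>(h)\<^sub>j \<in> V\<^sub>j + F\<^sub>j\<^sub>-\<^sub>1\<close>, in whose coordinates the multiplication \<open>\<phi> : g\<^sub>e \<times> h \<rightarrow> g\<close> is triangular with
  unit diagonal. The solution of \<open>\<phi>(t) = X\<close> is the \<open>m\<close>-th iterate of \<open>t \<mapsto> t + coord (X - \<phi>(t))\<close> at \<open>0\<close>, which is
  polynomial in \<open>X\<close> and the basis. Analyticity of \<open>\<beta>\<close> comes from the formula
  \<open>1 - P\<^sub>U (P\<^sub>W + P\<^sub>U)\<^sup>-\<^sup>1\<close> for the projection onto \<open>W\<close> along \<open>U\<close>, where \<open>P\<^sub>W\<close>, \<open>P\<^sub>U\<close> are the
  orthogonal projections.\<close>

section \<open>Polynomial maps\<close>

lemma polynomial_function_linear_compose: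
  assumes "bounded_linear L" "polynomial_function f"
  shows "polynomial_function (\<lambda>x. L (f x))"
  using polynomial_function_compose[OF assms(2) polynomial_function_bounded_linear[OF assms(1)]]
  by (simp add: o_def)

lemma polynomial_function_vec_lambda:
  fixes f :: "'a::real_normed_vector \<Rightarrow> 'm::finite \<Rightarrow> 'b::euclidean_space"
  assumes "\<And>i. polynomial_function (\<lambda>x. f x i)"
  shows "polynomial_function (\<lambda>x. \<chi> i. f x i)"
  unfolding polynomial_function_iff_Basis_inner
proof
  fix b :: "'b ^ 'm"
  assume "b \<in> Basis"
  then obtain i c where "b = axis i c"
    by (auto simp: Basis_vec_def)
  then have "(\<lambda>x. (\<chi> i. f x i) \<bullet> b) = (\<lambda>x. f x i \<bullet> c)"
    by (simp add: inner_axis)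
  then show "real_polynomial_function (\<lambda>x. (\<chi> i. f x i) \<bullet> b)"
    using polynomial_function_linear_compose[OF bounded_linear_inner_left assms]
    by (simp add: real_polynomial_function_eq)
qed

lemma polynomial_function_vec_nth:
  "polynomial_function f \<Longrightarrow> polynomial_function (\<lambda>x. f x $ i)"
  by (rule polynomial_function_linear_compose) auto

lemma polynomial_function_Pair:
  assumes "polynomial_function f" "polynomial_function g"
  shows "polynomial_function (\<lambda>x. (f x, g x))"
proof -
  have "bounded_linear (\<lambda>x. (x, 0))" "bounded_linear (\<lambda>x. (0, x))"
    by (intro bounded_linear_Pair bounded_linear_ident bounded_linear_zero)+
  from polynomial_function_add[OF polynomial_function_linear_compose[OF this(1) assms(1)]
      polynomial_function_linear_compose[OF this(2) assms(2)]]
  show ?thesis by simp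
qed

lemma polynomial_function_bilinear:
  fixes h :: "'b::euclidean_space \<Rightarrow> 'c::euclidean_space \<Rightarrow> 'd::real_normed_vector"
  assumes "bilinear h" "polynomial_function f" "polynomial_function g"
  shows "polynomial_function (\<lambda>x. h (f x) (g x))"
proof -
  have expand: "h u v = (\<Sum>(i, j)\<in>Basis \<times> Basis. ((u \<bullet> i) * (v \<bullet> j)) *\<^sub>R h i j)" for u v
  proof -
    have "h u v = h (\<Sum>i\<in>Basis. (u \<bullet> i) *\<^sub>R i) (\<Sum>j\<in>Basis. (v \<bullet> j) *\<^sub>R j)"
      by (simp add: euclidean_representation)
    also have "\<dots> = (\<Sum>(i, j)\<in>Basis \<times> Basis. h ((u \<bullet> i) *\<^sub>R i) ((v \<bullet> j) *\<^sub>R j))"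
      by (rule bilinear_sum) fact
    finally show ?thesis
      by (simp add: bilinear_lmul[OF assms(1)] bilinear_rmul[OF assms(1)] mult.commute)
  qed
  have eq: "(\<lambda>x. h (f x) (g x)) =
      (\<lambda>x. \<Sum>p\<in>Basis \<times> Basis. (f x \<bullet> fst p) *\<^sub>R (g x \<bullet> snd p) *\<^sub>R h (fst p) (snd p))"
    by (intro ext, subst expand) (simp only: scaleR_scaleR split_def)
  show ?thesis
    unfolding eq
    by (intro polynomial_function_sum polynomial_function_mult polynomial_function_const
        polynomial_function_linear_compose[OF bounded_linear_inner_left] assms) simp
qed

text \<open>Only the vector argument is expanded: each summand is a coordinate of \<open>g x\<close>
  times the value of \<open>f x\<close> at a fixed basis vector, which is linear in the
  operator.\<close>

lemma polynomial_function_blinfun_apply: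
  fixes f :: "'a::real_normed_vector \<Rightarrow> 'b::euclidean_space \<Rightarrow>\<^sub>L 'c::real_normed_vector"
  assumes "polynomial_function f" "polynomial_function g"
  shows "polynomial_function (\<lambda>x. blinfun_apply (f x) (g x))"
proof -
  have "blinfun_apply L u = (\<Sum>i\<in>Basis. (u \<bullet> i) *\<^sub>R blinfun_apply L i)"
    for L :: "'b \<Rightarrow>\<^sub>L 'c" and u
    by (subst euclidean_representation[of u, symmetric]) (simp add: blinfun.sum_right blinfun.scaleR_right)
  then have eq: "(\<lambda>x. blinfun_apply (f x) (g x)) = (\<lambda>x. \<Sum>i\<in>Basis. (g x \<bullet> i) *\<^sub>R blinfun_apply (f x) i)"
    by (intro ext)
  show ?thesis
    unfolding eq
    by (intro polynomial_function_sum polynomial_function_mult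
        polynomial_function_linear_compose[OF bounded_linear_inner_left]
        polynomial_function_linear_compose[OF blinfun.bounded_linear_left] assms) simp
qed

section \<open>Real analytic maps\<close>

lemma real_analytic_at_const: "real_analytic_at (\<lambda>x. c) a"
  unfolding real_analytic_at_def
proof (intro exI conjI allI impI)
  show "polynomial_function (\<lambda>v. if n = (0::nat) then c else 0)" for n by simp
  show "(\<lambda>n. if n = 0 then c else 0) sums c" for v using sums_single[of 0 "\<lambda>_. c"] by simp
  show "norm (if n = 0 then c else 0) \<le> norm c * (norm v / 1) ^ n" for n v by simp
qed auto

text \<open>The constant joins the term of degree 0, so the radius stays the same and the bound
  grows by \<open>norm c\<close>.\<close>

lemma real_analytic_at_add_const:
  assumes "real_analytic_at f a"
  shows "real_analytic_at (\<lambda>x. c + f x) a"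
proof -
  obtain r C P where "r > 0"
    and poly: "\<And>n. polynomial_function (P n)"
    and hom: "\<And>n t v. P n (t *\<^sub>R v) = t ^ n *\<^sub>R P n v"
    and bound: "\<And>n v. norm (P n v) \<le> C * (norm v / r) ^ n"
    and sums: "\<And>v. norm v < r \<Longrightarrow> (\<lambda>n. P n v) sums f (a + v)"
    using assms unfolding real_analytic_at_def by blast
  show ?thesis
    unfolding real_analytic_at_def
  proof (intro exI conjI allI impI)
    let ?Q = "\<lambda>n v. (if n = 0 then c else 0) + P n v"
    show "polynomial_function (?Q n)" for n using poly[of n] by auto
    show "?Q n (t *\<^sub>R v) = t ^ n *\<^sub>R ?Q n v" for n t v
      using hom[of n t v] by (simp add: scaleR_add_right)
    show "norm (?Q n v) \<le> (norm c + C) * (norm v / r) ^ n" for n v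
    proof -
      have "norm (?Q n v) \<le> norm (if n = 0 then c else 0) + norm (P n v)"
        by (rule norm_triangle_ineq)
      also have "norm (if n = 0 then c else 0) \<le> norm c * (norm v / r) ^ n"
        using \<open>r > 0\<close> by simp
      finally show ?thesis using bound[of n v] by (simp add: algebra_simps)
    qed
    show "(\<lambda>n. ?Q n v) sums (c + f (a + v))" if "norm v < r" for v
      using sums_add[OF _ sums[OF that]] sums_single[of 0 "\<lambda>_. c"] by auto
  qed fact
qed

text \<open>Finitely many coordinates share a radius, the least of theirs, and summing the constants
  bounds the norm of the vector.\<close>

lemma real_analytic_at_vec:
  fixes f :: "'a::real_normed_vector \<Rightarrow> 'b::euclidean_space ^ 'm::finite"
  assumes "\<And>i. real_analytic_at (\<lambda>x. f x $ i) a"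
  shows "real_analytic_at f a"
proof -
  obtain r C P where r: "\<And>i. r i > 0"
    and poly: "\<And>i n. polynomial_function (P i n)"
    and hom: "\<And>i n t v. P i n (t *\<^sub>R v) = t ^ n *\<^sub>R P i n v"
    and bound: "\<And>i n v. norm (P i n v) \<le> C i * (norm v / r i) ^ n"
    and sums: "\<And>i v. norm v < r i \<Longrightarrow> (\<lambda>n. P i n v) sums (f (a + v) $ i)"
    using assms unfolding real_analytic_at_def by metis
  define s where "s = Min (range r)"
  have s: "s \<le> r i" for i unfolding s_def by simp
  have "s > 0" unfolding s_def using r by simp
  show ?thesis
    unfolding real_analytic_at_def
  proof (intro exI conjI allI impI)
    let ?Q = "\<lambda>n v. \<chi> i. P i n v"
    show "polynomial_function (?Q n)" for n
      by (intro polynomial_function_vec_lambda poly)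
    show "?Q n (t *\<^sub>R v) = t ^ n *\<^sub>R ?Q n v" for n t v
      by (simp add: vec_eq_iff hom)
    show "norm (?Q n v) \<le> (\<Sum>i\<in>UNIV. \<bar>C i\<bar>) * (norm v / s) ^ n" for n v
    proof -
      have "norm (?Q n v) \<le> (\<Sum>i\<in>UNIV. norm (P i n v))"
        unfolding norm_vec_def using L2_set_le_sum[of UNIV "\<lambda>i. norm (?Q n v $ i)"] by simp
      also have "\<dots> \<le> (\<Sum>i\<in>UNIV. \<bar>C i\<bar> * (norm v / s) ^ n)"
      proof (rule sum_mono)
        fix i
        have "norm (P i n v) \<le> C i * (norm v / r i) ^ n" by (rule bound)
        also have "\<dots> \<le> \<bar>C i\<bar> * (norm v / s) ^ n"
          using r[of i] s[of i] \<open>s > 0\<close>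
          by (intro mult_mono power_mono divide_left_mono) auto
        finally show "norm (P i n v) \<le> \<bar>C i\<bar> * (norm v / s) ^ n" .
      qed
      finally show ?thesis by (simp add: sum_distrib_right)
    qed
    show "(\<lambda>n. ?Q n v) sums f (a + v)" if "norm v < s" for v
    proof -
      have "(\<lambda>n. P i n v) sums (f (a + v) $ i)" for i
        using sums[of v i] s[of i] that by simp
      then show ?thesis
        unfolding sums_def by (intro vec_tendstoI) (simp add: sum_component)
    qed
  qed fact
qed

lemma real_analytic_at_translate:
  assumes "real_analytic_at f (a + c)"
  shows "real_analytic_at (\<lambda>x. f (x + c)) a"
  using assms unfolding real_analytic_at_def by (simp add: algebra_simps)

section \<open>Inverses of linear operators and the Neumann series\<close>

lemma inv_blinfun:
  fixes A :: "'a::euclidean_space \<Rightarrow>\<^sub>L 'a"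
  assumes "inj (blinfun_apply A)"
  obtains B where "\<And>x. blinfun_apply B x = inv (blinfun_apply A) x"
    "\<And>x. blinfun_apply A (blinfun_apply B x) = x"
proof -
  have lin: "linear (blinfun_apply A)"
    by (simp add: blinfun.bounded_linear_right bounded_linear.linear)
  have "surj (blinfun_apply A)"
    using linear_injective_imp_surjective[OF lin assms] by simp
  moreover have "linear (inv (blinfun_apply A))"
    using lin assms by (rule inj_linear_imp_inv_linear)
  then have "blinfun_apply (Blinfun (inv (blinfun_apply A))) = inv (blinfun_apply A)"
    by (simp add: bounded_linear_Blinfun_apply linear_conv_bounded_linear)
  ultimately show ?thesis
    using assms by (intro that[of "Blinfun (inv (blinfun_apply A))"]) (auto simp: surj_f_inv_f)
qed

lemma norm_funpow_blinfun_le: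
  fixes B H :: "'a::real_normed_vector \<Rightarrow>\<^sub>L 'a"
  shows "norm (((\<lambda>x. - blinfun_apply B (blinfun_apply H x)) ^^ n) x) \<le> (norm B * norm H) ^ n * norm x"
proof (induction n)
  case (Suc n)
  let ?y = "((\<lambda>x. - blinfun_apply B (blinfun_apply H x)) ^^ n) x"
  have "norm (blinfun_apply B (blinfun_apply H ?y)) \<le> norm B * norm (blinfun_apply H ?y)"
    by (rule norm_blinfun)
  also have "\<dots> \<le> norm B * (norm H * norm ?y)"
    by (intro mult_left_mono norm_blinfun) simp
  also have "\<dots> = (norm B * norm H) * norm ?y" by simp
  also have "\<dots> \<le> (norm B * norm H) * ((norm B * norm H) ^ n * norm x)"
    by (rule mult_left_mono[OF Suc]) simp
  finally show ?case by (simp add: mult.assoc)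
qed simp

text \<open>Neumann series: \<open>(A + H)\<^sup>-\<^sup>1 = \<Sum>n. (- A\<^sup>-\<^sup>1 H)\<^sup>n A\<^sup>-\<^sup>1\<close>.\<close>

lemma inv_add_sums:
  fixes A B H :: "'a::euclidean_space \<Rightarrow>\<^sub>L 'a"
  assumes AB: "\<And>x. blinfun_apply A (blinfun_apply B x) = x"
    and H: "norm B * norm H < 1"
  defines "T \<equiv> \<lambda>x. - blinfun_apply B (blinfun_apply H x)"
  shows "inj (blinfun_apply (A + H))"
    and "(\<lambda>n. (T ^^ n) (blinfun_apply B v)) sums inv (blinfun_apply (A + H)) v"
proof -
  have summable: "summable (\<lambda>n. (T ^^ n) (blinfun_apply B v))" for v
  proof (rule summable_comparison_test)
    show "\<exists>N. \<forall>n\<ge>N. norm ((T ^^ n) (blinfun_apply B v)) \<le>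
        (norm B * norm H) ^ n * norm (blinfun_apply B v)"
      unfolding T_def using norm_funpow_blinfun_le by blast
    show "summable (\<lambda>n. (norm B * norm H) ^ n * norm (blinfun_apply B v))"
      using H by (intro summable_mult2 summable_geometric) simp
  qed
  have solves: "blinfun_apply (A + H) (\<Sum>n. (T ^^ n) (blinfun_apply B v)) = v" for v
  proof -
    let ?x = "\<lambda>n. (T ^^ n) (blinfun_apply B v)"
    \<comment> \<open>Since \<open>A\<close> undoes \<open>B\<close>, applying \<open>A\<close> to
      \<open>T x\<close> gives \<open>- H x\<close>. So the image of the series under
      \<open>A + H\<close> telescopes, and only \<open>A (B v) = v\<close> survives.\<close>
    have "blinfun_apply (A + H) (?x n) = blinfun_apply A (?x n) - blinfun_apply A (?x (Suc n))" for n
      by (simp add: T_def blinfun.add_left blinfun.minus_right AB)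
    moreover have "(\<lambda>n. blinfun_apply A (?x n)) \<longlonglongrightarrow> 0"
      using blinfun.tendsto[OF tendsto_const summable_LIMSEQ_zero[OF summable[of v]], of A]
      by (simp add: blinfun.zero_right)
    then have "(\<lambda>n. blinfun_apply A (?x n) - blinfun_apply A (?x (Suc n))) sums
        (blinfun_apply A (?x 0) - 0)"
      by (rule telescope_sums')
    moreover have "(\<lambda>n. blinfun_apply (A + H) (?x n)) sums blinfun_apply (A + H) (\<Sum>n. ?x n)"
      by (intro bounded_linear.sums[OF blinfun.bounded_linear_right] summable_sums summable)
    ultimately have "(\<lambda>n. blinfun_apply (A + H) (?x n)) sums v"
      "(\<lambda>n. blinfun_apply (A + H) (?x n)) sums blinfun_apply (A + H) (\<Sum>n. ?x n)"
      by (simp_all add: AB)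
    then show ?thesis by (metis sums_unique2)
  qed
  then have "surj (blinfun_apply (A + H))"
    by (rule surjI)
  moreover have "linear (blinfun_apply (A + H))"
    by (simp add: blinfun.bounded_linear_right bounded_linear.linear)
  ultimately show inj: "inj (blinfun_apply (A + H))"
    by (intro linear_surjective_imp_injective) simp_all
  have "inv (blinfun_apply (A + H)) v = (\<Sum>n. (T ^^ n) (blinfun_apply B v))"
    using inv_f_eq[OF inj solves] .
  then show "(\<lambda>n. (T ^^ n) (blinfun_apply B v)) sums inv (blinfun_apply (A + H)) v"
    using summable_sums[OF summable] by simp
qed

text \<open>The Neumann series around \<open>A\<close> is the required expansion: its
  \<open>n\<close>-th term contains \<open>H\<close> exactly \<open>n\<close> times.\<close>

lemma real_analytic_at_blinfun_inv:
  fixes A L :: "'a::euclidean_space \<Rightarrow>\<^sub>L 'a"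
  assumes "inj (blinfun_apply A)"
  shows "real_analytic_at (\<lambda>P. blinfun_apply L (inv (blinfun_apply P) v)) A"
proof -
  obtain B where AB: "\<And>x. blinfun_apply A (blinfun_apply B x) = x"
    using inv_blinfun[OF assms] by metis
  define T where "T = (\<lambda>H :: 'a \<Rightarrow>\<^sub>L 'a. \<lambda>x. - blinfun_apply B (blinfun_apply H x))"
  \<comment> \<open>The \<open>+ 1\<close> keeps the denominator positive, and
    \<open>norm H < r\<close> still forces \<open>norm B * norm H < 1\<close>.\<close>
  define r where "r = 1 / (norm B + 1)"
  have r: "r > 0" "norm B * r \<le> 1"
    unfolding r_def by (auto simp: add_nonneg_pos divide_simps)
  have small: "norm B * norm H < 1" if "norm H < r" for H :: "'a \<Rightarrow>\<^sub>L 'a"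
  proof (cases "B = 0")
    case False
    then have "norm B * norm H < norm B * r" using that by simp
    then show ?thesis using r by simp
  qed simp
  have hom: "(T (t *\<^sub>R H) ^^ n) x = t ^ n *\<^sub>R (T H ^^ n) x" for t H n x
    by (induction n) (simp_all add: T_def blinfun.scaleR_left blinfun.scaleR_right)
  have poly: "polynomial_function (\<lambda>H. (T H ^^ n) x)" for n x
  proof (induction n)
    case (Suc n)
    then show ?case
      by (auto simp: T_def intro!: polynomial_function_minus polynomial_function_blinfun_apply)
  qed simp
  show ?thesis
    unfolding real_analytic_at_def
  proof (intro exI conjI allI impI)
    let ?P = "\<lambda>n H. blinfun_apply L ((T H ^^ n) (blinfun_apply B v))"
    show "r > 0" by fact
    show "polynomial_function (?P n)" for n
      by (intro polynomial_function_blinfun_apply poly) simp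
    show "?P n (t *\<^sub>R H) = t ^ n *\<^sub>R ?P n H" for n t H
      by (simp add: hom blinfun.scaleR_right)
    show "(\<lambda>n. ?P n H) sums blinfun_apply L (inv (blinfun_apply (A + H)) v)" if "norm H < r" for H
      unfolding T_def
      by (intro bounded_linear.sums[OF blinfun.bounded_linear_right] inv_add_sums(2)[OF AB small] that)
    show "norm (?P n H) \<le> norm L * norm (blinfun_apply B v) * (norm H / r) ^ n" for n H
    proof -
      have "norm (?P n H) \<le> norm L * norm ((T H ^^ n) (blinfun_apply B v))"
        by (rule norm_blinfun)
      also have "\<dots> \<le> norm L * ((norm B * norm H) ^ n * norm (blinfun_apply B v))"
        unfolding T_def by (intro mult_left_mono norm_funpow_blinfun_le) simp
      also have "\<dots> \<le> norm L * ((norm H / r) ^ n * norm (blinfun_apply B v))"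
        using r mult_right_mono[OF r(2), of "norm H"]
        by (intro mult_left_mono mult_right_mono power_mono) (auto simp: field_simps)
      finally show ?thesis by (simp add: ac_simps)
    qed
  qed
qed

lemma open_inj_blinfun: "open {P :: 'a::euclidean_space \<Rightarrow>\<^sub>L 'a. inj (blinfun_apply P)}"
  unfolding open_contains_ball
proof
  fix A :: "'a \<Rightarrow>\<^sub>L 'a"
  assume "A \<in> {P. inj (blinfun_apply P)}"
  then obtain B where AB: "\<And>x. blinfun_apply A (blinfun_apply B x) = x"
    using inv_blinfun by (metis mem_Collect_eq)
  have "inj (blinfun_apply P)" if "P \<in> ball A (1 / (norm B + 1))" for P
  proof -
    have "norm B * norm (P - A) \<le> (norm B + 1) * norm (P - A)"
      by (simp add: mult_right_mono)
    also have "\<dots> < 1"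
      using that by (simp add: dist_norm norm_minus_commute pos_less_divide_eq add_nonneg_pos mult.commute)
    finally show ?thesis using inv_add_sums(1)[OF AB, of "P - A"] by simp
  qed
  then show "\<exists>d>0. ball A d \<subseteq> {P. inj (blinfun_apply P)}"
    by (intro exI[of _ "1 / (norm B + 1)"]) (auto simp: add_nonneg_pos)
qed

section \<open>Oblique projections\<close>

text \<open>If \<open>P\<^sub>W y + P\<^sub>U y = 0\<close>, pairing with \<open>y\<close> shows
  that the squared norms of \<open>P\<^sub>W y\<close> and \<open>P\<^sub>U y\<close> add up to 0.
  So \<open>y\<close> is orthogonal to \<open>W\<close> and to \<open>U\<close>, hence to their sum,
  the whole space.\<close>

lemma inj_orth_proj_add:
  fixes U W :: "'a::euclidean_space set"
  assumes "subspace U" "W \<in> Gr_compl U"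
  shows "inj (blinfun_apply (orth_proj W + orth_proj U))"
proof -
  have W: "subspace W" and UW: "U + W = UNIV"
    using assms(2) by (auto simp: Gr_compl_def)
  have "y = 0" if y: "blinfun_apply (orth_proj W + orth_proj U) y = 0" for y
  proof -
    let ?P = "blinfun_apply (orth_proj W)" and ?E = "blinfun_apply (orth_proj U)"
    have orth: "(y - ?P y) \<bullet> w = 0" "(y - ?E y) \<bullet> u = 0" if "w \<in> W" "u \<in> U" for u w
      using orth_proj(2)[OF W that(1)] orth_proj(2)[OF assms(1) that(2)] by (auto simp: orthogonal_def)
    have "?P y \<bullet> ?P y + ?E y \<bullet> ?E y = y \<bullet> (?P y + ?E y)"
      using orth[OF orth_proj(1)[OF W, of y] orth_proj(1)[OF assms(1), of y]]
      by (simp add: inner_diff_left inner_add_right)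
    also have "\<dots> = 0"
      using y by (simp add: blinfun.add_left)
    finally have "?P y = 0" "?E y = 0"
      by (simp_all add: add_nonneg_eq_0_iff)
    then have "y \<bullet> (u + w) = 0" if "w \<in> W" "u \<in> U" for u w
      using orth[OF that] by (simp add: inner_add_right)
    moreover obtain u w where "u \<in> U" "w \<in> W" "y = u + w"
      using UW by (metis UNIV_I set_plus_elim)
    ultimately show ?thesis by (metis inner_eq_zero_iff)
  qed
  moreover have "linear (blinfun_apply (orth_proj W + orth_proj U))"
    by (simp add: blinfun.bounded_linear_right bounded_linear.linear)
  ultimately show ?thesis
    by (simp add: linear_injective_0)
qed

text \<open>The projection onto \<open>W\<close> along \<open>U\<close>: if \<open>x = (P\<^sub>W + P\<^sub>U) y\<close>, then \<open>P\<^sub>W y\<close> and \<open>P\<^sub>U y\<close> are the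
  components of \<open>x\<close>.\<close>

definition oblique_proj :: "'a::euclidean_space set \<Rightarrow> 'a set \<Rightarrow> 'a \<Rightarrow> 'a" where
  "oblique_proj U W x =
     x - blinfun_apply (orth_proj U) (inv (blinfun_apply (orth_proj W + orth_proj U)) x)"

lemma linear_oblique_proj:
  assumes "subspace U" "W \<in> Gr_compl U"
  shows "linear (oblique_proj U W)"
proof -
  obtain B where "\<And>x. blinfun_apply B x = inv (blinfun_apply (orth_proj W + orth_proj U)) x"
    using inv_blinfun[OF inj_orth_proj_add[OF assms]] by metis
  then have "oblique_proj U W = (\<lambda>x. x - blinfun_apply (orth_proj U) (blinfun_apply B x))"
    by (simp add: oblique_proj_def fun_eq_iff)
  then show ?thesis
    by (intro linearI) (simp_all add: blinfun.add_right blinfun.scaleR_right scaleR_diff_right)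
qed

text \<open>Writing \<open>u + w = P\<^sub>W y + P\<^sub>U y\<close>, the vector
  \<open>P\<^sub>U y - u = w - P\<^sub>W y\<close> lies in both \<open>U\<close> and
  \<open>W\<close>, so it is 0.\<close>

lemma oblique_proj_add:
  assumes "subspace U" "W \<in> Gr_compl U" "u \<in> U" "w \<in> W"
  shows "oblique_proj U W (u + w) = w"
proof -
  have W: "subspace W" and UW: "U \<inter> W = {0}"
    using assms(2) by (auto simp: Gr_compl_def)
  define y where "y = inv (blinfun_apply (orth_proj W + orth_proj U)) (u + w)"
  let ?P = "blinfun_apply (orth_proj W) y" and ?E = "blinfun_apply (orth_proj U) y"
  have "blinfun_apply (orth_proj W + orth_proj U) y = u + w"
    unfolding y_def using inv_blinfun[OF inj_orth_proj_add[OF assms(1,2)]] by metis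
  then have "?P + ?E = u + w"
    by (simp add: blinfun.add_left)
  then have eq: "?E - u = w - ?P"
    by (simp add: algebra_simps)
  have "?E - u \<in> U" "w - ?P \<in> W"
    using assms W by (auto intro!: subspace_diff orth_proj(1))
  then have "?E - u \<in> U \<inter> W" using eq by simp
  then have "?E = u" using UW by simp
  then show ?thesis
    unfolding oblique_proj_def by (simp add: y_def)
qed

text \<open>Replacing \<open>orth_proj W\<close> by an operator variable \<open>P\<close> in the
  formula for the projection gives an analytic map on the open set where
  \<open>P + orth_proj U\<close> is injective; this is the local extension that analyticity on the
  Grassmannian asks for.\<close>

lemma Gr_analytic_on_oblique_proj:
  fixes v :: "'a::euclidean_space ^ 'm::finite"
  assumes "subspace U"
  shows "Gr_analytic_on (Gr_compl U) (\<lambda>W. \<chi> j. if j \<in> e then v $ j else oblique_proj U W (v $ j))"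
  unfolding Gr_analytic_on_def
proof
  fix W
  assume W: "W \<in> Gr_compl U"
  define S where "S = {P. inj (blinfun_apply (P + orth_proj U))}"
  define g where "g = (\<lambda>P. (\<chi> j. if j \<in> e then v $ j else
    v $ j - blinfun_apply (orth_proj U) (inv (blinfun_apply (P + orth_proj U)) (v $ j))) :: 'a ^ 'm)"
  have "S = (\<lambda>P. P + orth_proj U) -` {P. inj (blinfun_apply P)}"
    by (auto simp: S_def)
  then have "open S"
    by (simp only:) (intro open_vimage open_inj_blinfun continuous_intros)
  moreover have "orth_proj W \<in> S"
    using inj_orth_proj_add[OF assms W] by (simp add: S_def)
  moreover have "real_analytic_at g P" if "P \<in> S" for P
  proof (rule real_analytic_at_vec)
    fix j
    have "real_analytic_at (\<lambda>P. v $ j +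
        blinfun_apply (- orth_proj U) (inv (blinfun_apply (P + orth_proj U)) (v $ j))) P"
      using that unfolding S_def
      by (intro real_analytic_at_add_const real_analytic_at_translate[where c = "orth_proj U"
            and f = "\<lambda>P. blinfun_apply (- orth_proj U) (inv (blinfun_apply P) (v $ j))"]
          real_analytic_at_blinfun_inv) simp
    then show "real_analytic_at (\<lambda>P. g P $ j) P"
      by (cases "j \<in> e") (simp_all add: g_def real_analytic_at_const blinfun.minus_left)
  qed
  moreover have "(\<chi> j. if j \<in> e then v $ j else oblique_proj U W' (v $ j)) = g (orth_proj W')" for W'
    by (simp add: g_def oblique_proj_def vec_eq_iff)
  ultimately show "\<exists>S g. open S \<and> orth_proj W \<in> S \<and> (\<forall>P\<in>S. real_analytic_at g P) \<and>
      (\<forall>W'\<in>Gr_compl U. orth_proj W' \<in> S \<longrightarrow>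
        (\<chi> j. if j \<in> e then v $ j else oblique_proj U W' (v $ j)) = g (orth_proj W'))"
    by blast
qed

section \<open>The Dynkin series\<close>

lemma length_dynkin_word: "length (dynkin_word X Y ps) = (\<Sum>(r, s)\<leftarrow>ps. r + s)"
  unfolding dynkin_word_def by (induction ps) auto

lemma dynkin_index_0: "dynkin_index 0 = {}"
  unfolding dynkin_index_def by (auto simp: neq_Nil_conv)

lemma dynkin_index_1: "dynkin_index 1 = {[(1, 0)], [(0, 1)]}"
proof -
  have "ps = [(1, 0)] \<or> ps = [(0, 1)]" if "ps \<in> dynkin_index 1" for ps
  proof -
    obtain x qs where "ps = x # qs"
      using \<open>ps \<in> dynkin_index 1\<close> unfolding dynkin_index_def by (auto simp: neq_Nil_conv)
    moreover obtain r s where "x = (r, s)" by fastforce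
    ultimately have "ps = (r, s) # qs" "r + s > 0" and
      sum: "r + s + (\<Sum>(r, s)\<leftarrow>qs. r + s) = 1" and pos: "\<forall>(r, s) \<in> set qs. r + s > 0"
      using that unfolding dynkin_index_def by auto
    moreover have "qs = []"
      using \<open>r + s > 0\<close> sum pos by (cases qs) auto
    ultimately show ?thesis by auto
  qed
  then show ?thesis
    by (auto simp: dynkin_index_def)
qed

lemma bch_component_1: "bch_component br 1 X Y = X + Y"
  by (simp add: bch_component_def dynkin_index_1 dynkin_coeff_def dynkin_word_def
      flip: One_nat_def) simp

text \<open>Words with the same exponents are compared letter by letter; the relation will be
  congruence modulo a member of the flag.\<close>

lemma list_all2_dynkin_word:
  assumes "R X X'" "R Y Y'"
  shows "list_all2 R (dynkin_word X Y ps) (dynkin_word X' Y' ps)"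
proof -
  have "list_all2 R (replicate n x) (replicate n x')" if "R x x'" for n x x'
    using that by (induction n) auto
  then show ?thesis
    unfolding dynkin_word_def using assms
    by (induction ps) (auto intro!: list_all2_appendI)
qed

lemma polynomial_function_nested_bracket:
  fixes br :: "'a::euclidean_space \<Rightarrow> 'a \<Rightarrow> 'a"
  assumes "bilinear br" "\<forall>f\<in>set fs. polynomial_function f"
  shows "polynomial_function (\<lambda>x. nested_bracket br (map (\<lambda>f. f x) fs))"
  using assms(2)
proof (induction fs rule: induct_list012)
  case (3 f g fs)
  then show ?case
    using polynomial_function_bilinear[OF assms(1), of f
        "\<lambda>x. nested_bracket br (map (\<lambda>f. f x) (g # fs))"]
    by simp
qed simp_all

lemma polynomial_function_bch_component:
  fixes br :: "'a::euclidean_space \<Rightarrow> 'a \<Rightarrow> 'a"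
  assumes "bilinear br" "polynomial_function f" "polynomial_function g"
  shows "polynomial_function (\<lambda>x. bch_component br n (f x) (g x))"
proof -
  \<comment> \<open>The word is formed once with the functions \<open>f\<close> and \<open>g\<close>
    as letters and then evaluated at \<open>x\<close>.\<close>
  have "dynkin_word (f x) (g x) ps = map (\<lambda>f. f x) (dynkin_word f g ps)" for x ps
    unfolding dynkin_word_def by (induction ps) auto
  moreover have "\<forall>h\<in>set (dynkin_word f g ps). polynomial_function h" for ps
    unfolding dynkin_word_def using assms by auto
  ultimately show ?thesis
    unfolding bch_component_def
    by (auto intro!: polynomial_function_sum polynomial_function_cmul finite_dynkin_index
        polynomial_function_nested_bracket[OF assms(1)])
qed

section \<open>Jordan-Hoelder flags\<close>

lemma pos_less: "i < j \<Longrightarrow> pos i < pos j"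
  unfolding pos_def by (rule psubset_card_mono) auto

lemma bij_betw_pos: "bij_betw (pos :: 'm::{finite,linorder} \<Rightarrow> nat) UNIV {1..CARD('m)}"
proof -
  have inj: "inj (pos :: 'm \<Rightarrow> nat)"
    by (metis injI linorder_neqE pos_less less_irrefl)
  moreover have "pos i \<in> {1..CARD('m)}" for i :: 'm
    unfolding pos_def using card_gt_0_iff[of "{..i}"] card_mono[of UNIV "{..i}"] by auto
  ultimately show ?thesis
    unfolding bij_betw_def by (intro conjI card_subset_eq) (auto simp: card_image)
qed

locale jh_flag =
  fixes br :: "'a::euclidean_space \<Rightarrow> 'a \<Rightarrow> 'a" and F :: "nat \<Rightarrow> 'a set"
  assumes bilinear_br: "bilinear br"
    and br_self: "br x x = 0"
    and jh: "jh_sequence br F"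
begin

lemma subspace_F: "k \<le> DIM('a) \<Longrightarrow> subspace (F k)"
  using jh by (simp add: jh_sequence_def)

lemma F_0: "F 0 = {0}" and F_DIM: "F DIM('a) = UNIV"
  using jh by (simp_all add: jh_sequence_def)

lemma F_mono: "i \<le> j \<Longrightarrow> j \<le> DIM('a) \<Longrightarrow> F i \<subseteq> F j"
proof (induction rule: dec_induct)
  case (step n)
  then have "F n \<subseteq> F (Suc n)" using jh by (simp add: jh_sequence_def)
  then show ?case using step by auto
qed simp

lemma br_F_right: "br x y \<in> F (k - 1)" if "k \<le> DIM('a)" "y \<in> F k"
proof (cases k)
  \<comment> \<open>With truncated subtraction \<open>k - 1\<close> is 0 here, and the bracket with
    \<open>y = 0\<close> lies in \<open>F 0\<close>.\<close>
  case 0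
  then show ?thesis using that F_0 bilinear_rzero[OF bilinear_br] by simp
next
  case (Suc l)
  then have "k \<in> {1..DIM('a)}" using that by simp
  then show ?thesis using that jh unfolding jh_sequence_def by blast
qed

lemma br_F_left: "br y x \<in> F (k - 1)" if "k \<le> DIM('a)" "y \<in> F k"
proof -
  have "br y x = - br x y"
    using br_self[of "x + y"]
    by (simp add: bilinear_ladd[OF bilinear_br] bilinear_radd[OF bilinear_br] br_self[of x]
        br_self[of y] eq_neg_iff_add_eq_0 add.commute)
  then show ?thesis
    using br_F_right[OF that] subspace_F[of "k - 1"] that(1) by (simp add: subspace_neg)
qed

text \<open>By dimension, \<open>F k\<close> and any one vector of \<open>F (Suc k)\<close> outside
  it span \<open>F (Suc k)\<close>.\<close>

lemma F_Suc_breakdown: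
  assumes "Suc k \<le> DIM('a)" "v \<in> F (Suc k)" "v \<notin> F k" "x \<in> F (Suc k)"
  obtains c where "x - c *\<^sub>R v \<in> F k"
proof -
  have sub: "subspace (F k)" "subspace (F (Suc k))" and dim: "dim (F k) = k" "dim (F (Suc k)) = Suc k"
    using jh assms(1) by (auto simp: jh_sequence_def)
  have span: "span (F k) = F k" using sub(1) by (rule span_eq_iff[THEN iffD2])
  have "span (insert v (F k)) = F (Suc k)"
  proof (rule subspace_dim_equal)
    show "span (insert v (F k)) \<subseteq> F (Suc k)"
      using assms F_mono[of k "Suc k"] sub by (intro span_minimal) auto
    show "dim (F (Suc k)) \<le> dim (span (insert v (F k)))"
      using assms(3) dim by (simp add: dim_insert span del: span_eq_iff)
  qed (use sub in auto)
  then show ?thesis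
    using that assms(4) span by (metis span_breakdown_eq)
qed

text \<open>The innermost letter lies in the top member of the flag and each bracket goes down one
  level. A word longer than the dimension therefore lands in \<open>F 0\<close>, which cuts off the
  series.\<close>

lemma nested_bracket_in_F: "nested_bracket br (x # xs) \<in> F (DIM('a) - length xs)"
proof (induction xs arbitrary: x)
  case (Cons y ys)
  show ?case using br_F_right[OF _ Cons[of y]] by simp
qed (simp add: F_DIM)

lemma nested_bracket_eq_0: "DIM('a) < length xs \<Longrightarrow> nested_bracket br xs = 0"
  using nested_bracket_in_F[of "hd xs" "tl xs"] F_0 by (cases xs) auto

text \<open>The nonlinear part of the series. Stopping at \<open>DIM('a)\<close> loses nothing,
  because longer brackets vanish.\<close>

definition bch_rest :: "'a \<Rightarrow> 'a \<Rightarrow> 'a" where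
  "bch_rest X Y = (\<Sum>n=2..DIM('a). bch_component br n X Y)"

lemma bch_eq: "bch br X Y = X + Y + bch_rest X Y"
proof -
  have "bch_component br n X Y = 0" if "DIM('a) < n" for n
    unfolding bch_component_def
    by (intro sum.neutral)
       (use that in \<open>auto simp: dynkin_index_def length_dynkin_word intro!: nested_bracket_eq_0\<close>)
  then have "bch br X Y = (\<Sum>n\<le>DIM('a). bch_component br n X Y)"
    unfolding bch_def by (intro suminf_finite) auto
  \<comment> \<open>Degree 0 has no index lists and degree 1 gives \<open>X + Y\<close>; degree 1 is
    in the range because the dimension is positive.\<close>
  also have "{..DIM('a)} = insert 0 (insert 1 {2..DIM('a)})"
    using DIM_positive[where 'a = 'a] by auto
  finally have "bch br X Y = bch_component br 0 X Y + (bch_component br 1 X Y + bch_rest X Y)"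
    by (simp add: bch_rest_def)
  then show ?thesis
    by (simp add: bch_component_1[unfolded One_nat_def] bch_component_def[of br 0] dynkin_index_0)
qed

lemma polynomial_function_bch:
  assumes "polynomial_function f" "polynomial_function g"
  shows "polynomial_function (\<lambda>x. bch br (f x) (g x))"
  unfolding bch_eq bch_rest_def
  by (intro polynomial_function_add polynomial_function_sum polynomial_function_bch_component
      bilinear_br assms) simp

text \<open>The difference splits into a change of the first letter and a change of the tail, each
  inside a bracket. A single letter is in no bracket and only stays in \<open>F k\<close>; hence the
  sharper claim asks for length 2, and the weaker one drives the induction.\<close>

lemma nested_bracket_diff_in_F:
  assumes "k \<le> DIM('a)" "list_all2 (\<lambda>x x'. x - x' \<in> F k) xs ys"
  shows "nested_bracket br xs - nested_bracket br ys \<in> F k \<and>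
    (2 \<le> length xs \<longrightarrow> nested_bracket br xs - nested_bracket br ys \<in> F (k - 1))"
  using assms(2)
proof (induction xs arbitrary: ys rule: induct_list012)
  case 1
  then show ?case using subspace_F[OF assms(1)] by (simp add: subspace_0)
next
  case (2 x)
  then show ?case by (auto simp: list_all2_Cons1)
next
  case (3 x y xs)
  then obtain x' y' ys' where ys: "ys = x' # y' # ys'" and x: "x - x' \<in> F k"
    and rest: "list_all2 (\<lambda>x x'. x - x' \<in> F k) (y # xs) (y' # ys')"
    by (auto simp: list_all2_Cons1)
  let ?u = "nested_bracket br (y # xs)" and ?u' = "nested_bracket br (y' # ys')"
  have u: "?u - ?u' \<in> F k" using 3 rest by blast
  have "br x ?u - br x' ?u' = br (x - x') ?u + br x' (?u - ?u')"
    by (simp add: bilinear_lsub[OF bilinear_br] bilinear_rsub[OF bilinear_br])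
  also have "\<dots> \<in> F (k - 1)"
    using assms(1) x u by (intro subspace_add subspace_F br_F_left br_F_right) auto
  finally have "br x ?u - br x' ?u' \<in> F (k - 1)" .
  then show ?case
    using F_mono[of "k - 1" k] assms(1) ys by auto
qed

text \<open>Every word of degree at least 2 contains a bracket, so a change of the arguments by
  elements of \<open>F k\<close> reaches the rest one level lower. This makes the multiplication
  triangular.\<close>

lemma bch_rest_diff_in_F:
  assumes "k \<le> DIM('a)" "X - X' \<in> F k" "Y - Y' \<in> F k"
  shows "bch_rest X Y - bch_rest X' Y' \<in> F (k - 1)"
proof -
  have sub: "subspace (F (k - 1))" using assms(1) by (intro subspace_F) simp
  have "dynkin_coeff ps *\<^sub>R nested_bracket br (dynkin_word X Y ps) -
      dynkin_coeff ps *\<^sub>R nested_bracket br (dynkin_word X' Y' ps) \<in> F (k - 1)"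
    if "ps \<in> dynkin_index n" "2 \<le> n" for n ps
  proof -
    have "2 \<le> length (dynkin_word X Y ps)"
      using that by (simp add: dynkin_index_def length_dynkin_word)
    then have "nested_bracket br (dynkin_word X Y ps) - nested_bracket br (dynkin_word X' Y' ps) \<in> F (k - 1)"
      using nested_bracket_diff_in_F[OF assms(1) list_all2_dynkin_word] assms by blast
    then show ?thesis
      using sub by (simp add: subspace_scale flip: scaleR_diff_right)
  qed
  then show ?thesis
    unfolding bch_rest_def bch_component_def sum_subtractf[symmetric]
    by (intro subspace_sum[OF sub]) simp
qed

end

section \<open>Coordinates with respect to a Jordan-Hoelder basis\<close>

definition lincomb :: "'a::real_vector ^ 'm::finite \<Rightarrow> real ^ 'm \<Rightarrow> 'a" where
  "lincomb B t = (\<Sum>j\<in>UNIV. (t $ j) *\<^sub>R (B $ j))"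

lemma linear_lincomb: "linear (lincomb B)"
  unfolding lincomb_def
  by (intro linearI) (simp_all add: scaleR_add_left sum.distrib scaleR_sum_right)

lemma lincomb_axis: "lincomb B (axis j c) = c *\<^sub>R (B $ j)"
proof -
  have "(axis j c $ i) *\<^sub>R (B $ i) = (if i = j then c *\<^sub>R (B $ i) else 0)" for i
    by (simp add: axis_def)
  then show ?thesis unfolding lincomb_def by simp
qed

locale jh_basis = jh_flag br F for br :: "'a::euclidean_space \<Rightarrow> 'a \<Rightarrow> 'a" and F +
  fixes V :: "'a ^ 'm::{finite,linorder}"
  assumes card_index: "CARD('m) = DIM('a)"
    and V_in_JH: "V \<in> JH F"
begin

lemma pos_bounds: "1 \<le> pos (j :: 'm)" "pos j \<le> DIM('a)"
  using bij_betw_apply[OF bij_betw_pos, of j] card_index by auto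

lemma ex_pos:
  assumes "Suc k \<le> DIM('a)"
  obtains j :: 'm where "pos j = Suc k"
proof -
  have "Suc k \<in> range (pos :: 'm \<Rightarrow> nat)"
    using assms card_index bij_betw_imp_surj_on[OF bij_betw_pos[where 'm = 'm]] by simp
  then show ?thesis using that by auto
qed

lemma pos_eq_iff: "pos i = pos j \<longleftrightarrow> i = (j :: 'm)"
  using bij_betw_imp_inj_on[OF bij_betw_pos[where 'm = 'm]] by (auto dest: injD)

lemma V_in_F: "V $ j \<in> F (pos j)" "V $ j \<notin> F (pos j - 1)"
  using V_in_JH by (auto simp: JH_def)

text \<open>At each level the vector \<open>V $ j\<close> with \<open>pos j = Suc k\<close> absorbs
  the leading part of \<open>x\<close> and leaves a remainder in \<open>F k\<close>.\<close>

lemma F_lincomb: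
  assumes "k \<le> DIM('a)" "x \<in> F k"
  shows "\<exists>t. x = lincomb V t \<and> (\<forall>j. k < pos j \<longrightarrow> t $ j = 0)"
  using assms
proof (induction k arbitrary: x)
  case 0
  then show ?case
    using F_0 linear_0[OF linear_lincomb] by (intro exI[of _ 0]) simp
next
  case (Suc k)
  obtain j :: 'm where j: "pos j = Suc k" using ex_pos Suc.prems(1) .
  obtain c where "x - c *\<^sub>R V $ j \<in> F k"
    using F_Suc_breakdown[OF Suc.prems(1) _ _ Suc.prems(2), of "V $ j"] V_in_F[of j] j by auto
  then obtain t where t: "x - c *\<^sub>R V $ j = lincomb V t" "\<forall>j. k < pos j \<longrightarrow> t $ j = 0"
    using Suc.IH[of "x - c *\<^sub>R V $ j"] Suc.prems(1) by auto
  have "x = lincomb V (t + axis j c)"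
    using t(1) by (simp add: linear_add[OF linear_lincomb] lincomb_axis algebra_simps)
  moreover have "\<forall>i. Suc k < pos i \<longrightarrow> (t + axis j c) $ i = 0"
    using t(2) j by (auto simp: axis_def)
  ultimately show ?case by blast
qed

definition coord :: "'a \<Rightarrow> (real, 'm) vec" where
  "coord = inv (lincomb V)"

lemma bij_lincomb: "bij (lincomb V)"
proof -
  have "surj (lincomb V)"
    using F_lincomb[OF order_refl] unfolding F_DIM by (auto simp: surj_def)
  moreover from this have "inj (lincomb V)"
    using card_index by (intro linear_surjective_imp_injective linear_lincomb) simp_all
  ultimately show ?thesis by (simp add: bij_def)
qed

lemma lincomb_coord [simp]: "lincomb V (coord x) = x"
  unfolding coord_def by (meson bij_lincomb bij_inv_eq_iff)

lemma coord_lincomb [simp]: "coord (lincomb V t) = t"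
  unfolding coord_def by (rule inv_f_f[OF bij_is_inj[OF bij_lincomb]])

lemma linear_coord: "linear coord"
proof (rule linearI)
  show "coord (x + y) = coord x + coord y" for x y
    using coord_lincomb[of "coord x + coord y"] by (simp add: linear_add[OF linear_lincomb])
  show "coord (c *\<^sub>R x) = c *\<^sub>R coord x" for c x
    using coord_lincomb[of "c *\<^sub>R coord x"] by (simp add: linear_scale[OF linear_lincomb])
qed

lemma coord_V: "coord (V $ j) = axis j 1"
  by (metis coord_lincomb lincomb_axis scaleR_one)

lemma lincomb_in_F:
  assumes "k \<le> DIM('a)" "\<And>j. pos j \<le> k \<Longrightarrow> B $ j \<in> F k" "\<And>j. k < pos j \<Longrightarrow> t $ j = 0"
  shows "(\<Sum>j\<in>A. (t $ j) *\<^sub>R (B $ j)) \<in> F k"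
proof (rule subspace_sum[OF subspace_F[OF assms(1)]])
  fix j
  show "(t $ j) *\<^sub>R (B $ j) \<in> F k"
    using assms subspace_F[OF assms(1)]
    by (cases "pos j \<le> k") (auto simp: subspace_scale subspace_0)
qed

lemma F_iff_coord:
  assumes "k \<le> DIM('a)"
  shows "x \<in> F k \<longleftrightarrow> (\<forall>j. k < pos j \<longrightarrow> coord x $ j = 0)"
proof
  assume "\<forall>j. k < pos j \<longrightarrow> coord x $ j = 0"
  then have "lincomb V (coord x) \<in> F k"
    unfolding lincomb_def using V_in_F(1) F_mono assms by (intro lincomb_in_F) blast+
  then show "x \<in> F k" by simp
qed (use F_lincomb[OF assms] in force)

end

section \<open>Inverting the multiplication in coordinates\<close>

context jh_basis
begin

text \<open>Only bases that are unipotent relative to \<open>V\<close> are needed; for them the leading coefficients,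
  which would otherwise enter as denominators, are all \<open>1\<close>.\<close>

definition unipotent :: "('a, 'm) vec \<Rightarrow> bool" where
  "unipotent B \<longleftrightarrow> (\<forall>j. B $ j - V $ j \<in> F (pos j - 1))"

lemma unipotent_in_JH:
  assumes "unipotent B"
  shows "B \<in> JH F"
proof -
  have "B $ j \<in> F (pos j) - F (pos j - 1)" for j
  proof -
    have sub: "subspace (F (pos j))" "subspace (F (pos j - 1))"
      using pos_bounds[of j] by (auto intro!: subspace_F)
    have d: "B $ j - V $ j \<in> F (pos j - 1)" using assms by (simp add: unipotent_def)
    then have "B $ j - V $ j \<in> F (pos j)"
      using F_mono[of "pos j - 1" "pos j"] pos_bounds[of j] by auto
    then have "(B $ j - V $ j) + V $ j \<in> F (pos j)"
      using V_in_F(1) sub(1) by (intro subspace_add)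
    moreover have "B $ j \<notin> F (pos j - 1)"
      using subspace_diff[OF sub(2) _ d, of "B $ j"] V_in_F(2)[of j] by auto
    ultimately show ?thesis by simp
  qed
  then show ?thesis by (simp add: JH_def)
qed

text \<open>One vector \<open>t\<close> carries the coordinates of both factors: indices in
  \<open>e\<close> belong to the left factor, the others to the right one.\<close>

definition bch_coord :: "'m set \<Rightarrow> ('a, 'm) vec \<Rightarrow> (real, 'm) vec \<Rightarrow> 'a" where
  "bch_coord e B t = bch br (\<Sum>j\<in>e. (t $ j) *\<^sub>R (B $ j)) (\<Sum>j\<in>- e. (t $ j) *\<^sub>R (B $ j))"

text \<open>The residual is measured in the fixed basis \<open>V\<close> rather than in
  \<open>B\<close>. Fixed points are exactly the solutions of
  \<open>bch_coord e B t = X\<close>.\<close>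

definition bch_step :: "'m set \<Rightarrow> 'a \<Rightarrow> ('a, 'm) vec \<Rightarrow> (real, 'm) vec \<Rightarrow> (real, 'm) vec" where
  "bch_step e X B t = t + coord (X - bch_coord e B t)"

text \<open>There is one iteration for each level of the flag. For unipotent \<open>B\<close> the
  result does not depend on the starting vector 0.\<close>

definition bch_solve :: "'m set \<Rightarrow> 'a \<Rightarrow> ('a, 'm) vec \<Rightarrow> (real, 'm) vec" where
  "bch_solve e X B = (bch_step e X B ^^ DIM('a)) 0"

text \<open>One step extends agreement by one level. In the difference of two steps the term
  \<open>t - s\<close> cancels; what is left comes from \<open>B - V\<close>, which goes down the
  flag because \<open>B\<close> is unipotent, and from \<open>bch_rest\<close>, which does so by
  \<open>bch_rest_diff_in_F\<close>.\<close>

lemma bch_step_agree: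
  assumes B: "unipotent B" and k: "k \<le> DIM('a)"
    and agree: "\<And>j. k < pos j \<Longrightarrow> t $ j = s $ j"
    and j: "k - 1 < pos j"
  shows "bch_step e X B t $ j = bch_step e X B s $ j"
proof -
  let ?x = "\<lambda>A t. \<Sum>j\<in>A. (t $ j) *\<^sub>R (B $ j)"
  let ?R = "\<lambda>t. bch_rest (?x e t) (?x (- e) t)"
  define D where "D = (\<chi> j. B $ j - V $ j)"
  have BF: "B $ i \<in> F k" if "pos i \<le> k" for i
    using unipotent_in_JH[OF B] F_mono[OF that k] by (auto simp: JH_def)
  have "?x A t - ?x A s = ?x A (t - s)" for A
    by (simp add: scaleR_diff_left sum_subtractf)
  moreover have "?x A (t - s) \<in> F k" for A
    using agree BF by (intro lincomb_in_F k) auto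
  ultimately have R: "?R t - ?R s \<in> F (k - 1)"
    by (intro bch_rest_diff_in_F k) auto
  have "k - 1 \<le> DIM('a)" using k by simp
  have D: "lincomb D (t - s) \<in> F (k - 1)"
    unfolding lincomb_def
  proof (rule subspace_sum[OF subspace_F])
    fix i
    show "((t - s) $ i) *\<^sub>R (D $ i) \<in> F (k - 1)"
    proof (cases "k < pos i")
      case True
      then show ?thesis
        using agree[of i] subspace_0[OF subspace_F[OF \<open>k - 1 \<le> DIM('a)\<close>]] by simp
    next
      case False
      then have "F (pos i - 1) \<subseteq> F (k - 1)" using k by (intro F_mono) auto
      then have "D $ i \<in> F (k - 1)" using B by (auto simp: unipotent_def D_def)
      then show ?thesis
        by (intro subspace_scale subspace_F \<open>k - 1 \<le> DIM('a)\<close>)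
    qed
  qed fact
  have total: "bch_coord e B t = lincomb B t + ?R t" for t
  proof -
    have "?x UNIV t = ?x e t + ?x (- e) t"
      using sum.union_disjoint[of e "- e" "\<lambda>j. (t $ j) *\<^sub>R (B $ j)"] by simp
    then show ?thesis unfolding bch_coord_def bch_eq lincomb_def by simp
  qed
  have "lincomb B (t - s) = lincomb V (t - s) + lincomb D (t - s)"
    unfolding lincomb_def D_def by (simp add: algebra_simps flip: sum.distrib)
  then have "bch_coord e B t - bch_coord e B s =
      lincomb V (t - s) + (lincomb D (t - s) + (?R t - ?R s))"
    by (simp add: total linear_diff[OF linear_lincomb, of B])
  then have "coord (bch_coord e B t) - coord (bch_coord e B s) =
      (t - s) + coord (lincomb D (t - s) + (?R t - ?R s))"
    by (simp add: linear_add[OF linear_coord] flip: linear_diff[OF linear_coord])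
  then have "bch_step e X B t - bch_step e X B s = - coord (lincomb D (t - s) + (?R t - ?R s))"
    by (simp add: bch_step_def linear_diff[OF linear_coord] algebra_simps)
  moreover have "coord (lincomb D (t - s) + (?R t - ?R s)) $ j = 0"
    using F_iff_coord[OF \<open>k - 1 \<le> DIM('a)\<close>] j
      subspace_add[OF subspace_F[OF \<open>k - 1 \<le> DIM('a)\<close>] D R] by blast
  ultimately have "(bch_step e X B t - bch_step e X B s) $ j = 0" by simp
  then show ?thesis by simp
qed

text \<open>Each step settles the coordinates of one further level, from the top down, so after
  \<open>DIM('a)\<close> steps the starting vector is forgotten.\<close>

lemma bch_step_funpow_eq:
  assumes "unipotent B"
  shows "(bch_step e X B ^^ DIM('a)) t = (bch_step e X B ^^ DIM('a)) s"
proof -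
  have "(bch_step e X B ^^ n) t $ j = (bch_step e X B ^^ n) s $ j"
    if "n \<le> DIM('a)" "DIM('a) - n < pos j" for n j
    using that
  proof (induction n arbitrary: j)
    case 0
    then show ?case using pos_bounds(2)[of j] by simp
  next
    case (Suc n)
    then show ?case
      by (simp, intro bch_step_agree[OF assms, of "DIM('a) - n"]) auto
  qed
  from this[of "DIM('a)"] show ?thesis
    using pos_bounds(1) by (simp add: vec_eq_iff Suc_le_eq)
qed

lemma bch_coord_eq_iff:
  assumes "unipotent B"
  shows "bch_coord e B t = X \<longleftrightarrow> t = bch_solve e X B"
proof
  assume "bch_coord e B t = X"
  then have fixed: "bch_step e X B t = t"
    using linear_0[OF linear_coord] by (simp add: bch_step_def)
  have "(bch_step e X B ^^ n) t = t" for n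
    by (induction n) (simp_all add: fixed)
  then show "t = bch_solve e X B"
    using bch_step_funpow_eq[OF assms, of e X t 0] by (simp add: bch_solve_def)
next
  assume t: "t = bch_solve e X B"
  \<comment> \<open>Starting at \<open>bch_step e X B 0\<close> instead of 0 advances the iteration
    by one step without changing its result, so the result is a fixed point.\<close>
  then have "bch_step e X B t = t"
    using bch_step_funpow_eq[OF assms, of e X "bch_step e X B 0" 0]
    by (simp add: bch_solve_def flip: funpow_swap1)
  then have "coord (X - bch_coord e B t) = coord 0"
    using linear_0[OF linear_coord] by (simp add: bch_step_def)
  then have "X - bch_coord e B t = 0"
    by (metis lincomb_coord)
  then show "bch_coord e B t = X" by simp
qed

text \<open>Each iterate arises from the previous one by sums, products, the multiplication and the
  linear map \<open>coord\<close>. The latter belongs to the fixed basis \<open>V\<close>, so no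
  inverse depending on \<open>B\<close> enters.\<close>

lemma polynomial_function_bch_solve: "polynomial_function (\<lambda>z. bch_solve e (fst z) (snd z))"
proof -
  have "polynomial_function (\<lambda>z. (bch_step e (fst z) (snd z) ^^ n) 0)" for n
  proof (induction n)
    case (Suc n)
    have fst: "polynomial_function (fst :: 'a \<times> ('a, 'm) vec \<Rightarrow> _)"
      and snd: "polynomial_function (\<lambda>z :: 'a \<times> ('a, 'm) vec. snd z $ j)" for j
      by (intro polynomial_function_bounded_linear bounded_linear_fst polynomial_function_vec_nth
          bounded_linear_snd)+
    have "bounded_linear coord"
      using linear_coord by (simp add: linear_conv_bounded_linear)
    then show ?case
      unfolding funpow.simps o_def bch_step_def[of e _ _ "(_ ^^ n) _"] bch_coord_def
      by (intro polynomial_function_add Suc polynomial_function_linear_compose[of coord]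
          polynomial_function_diff polynomial_function_bch polynomial_function_sum
          polynomial_function_mult polynomial_function_vec_nth[OF Suc] fst snd)
         simp_all
  qed simp
  then show ?thesis unfolding bch_solve_def .
qed

end

section \<open>Subspaces with a given jump set\<close>

context jh_basis
begin

definition span_on :: "'m set \<Rightarrow> 'a set" where
  "span_on e = span {V $ j | j. j \<in> e}"

lemma subspace_span_on: "subspace (span_on e)"
  by (simp add: span_on_def)

lemma V_in_span_on: "j \<in> e \<Longrightarrow> V $ j \<in> span_on e"
  unfolding span_on_def by (rule span_base) blast

lemma coord_span_on:
  assumes "x \<in> span_on e" "j \<notin> e"
  shows "coord x $ j = 0"
proof -
  have "span_on e \<subseteq> {x. coord x $ j = 0}"
    unfolding span_on_def
  proof (rule span_minimal)
    show "{V $ j | j. j \<in> e} \<subseteq> {x. coord x $ j = 0}"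
      using assms(2) by (auto simp: coord_V axis_def)
    show "subspace {x. coord x $ j = 0}"
      by (rule subspaceI)
         (simp_all add: linear_0[OF linear_coord] linear_add[OF linear_coord] linear_scale[OF linear_coord])
  qed
  then show ?thesis using assms(1) by blast
qed

text \<open>An element of \<open>h\<close> in \<open>F (pos j)\<close> but outside the member below
  would generate \<open>F (pos j)\<close> modulo that member, which the jump at \<open>j\<close>
  forbids.\<close>

lemma jump_lowers:
  fixes j :: 'm
  assumes h: "subspace h" and j: "j \<in> jump F h" and x: "x \<in> h" "x \<in> F (pos j)"
  shows "x \<in> F (pos j - 1)"
proof (rule ccontr)
  assume nx: "x \<notin> F (pos j - 1)"
  obtain k where k: "pos j = Suc k" using pos_bounds(1)[of j] by (cases "pos j") auto
  have "F (pos j) \<subseteq> h + F (pos j - 1)"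
  proof
    fix y
    assume "y \<in> F (pos j)"
    then obtain c where c: "y - c *\<^sub>R x \<in> F k"
      using F_Suc_breakdown[of k x y] nx x k pos_bounds(2)[of j] by auto
    have "c *\<^sub>R x + (y - c *\<^sub>R x) \<in> h + F k"
      using subspace_scale[OF h x(1)] c by (rule set_plus_intro)
    then show "y \<in> h + F (pos j - 1)" using k by simp
  qed
  then show False using j by (simp add: jump_def)
qed

text \<open>Descent along the flag: at a jump index membership in \<open>h\<close> pushes
  \<open>x\<close> one level down; at any other index membership in \<open>span_on\<close> does,
  since the leading coordinate is 0.\<close>

lemma span_on_jump_Int:
  assumes h: "subspace h"
  shows "span_on (jump F h) \<inter> h = {0}"
proof -
  have "x = 0" if "k \<le> DIM('a)" "x \<in> F k" "x \<in> span_on (jump F h)" "x \<in> h" for k x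
    using that
  proof (induction k)
    case 0
    then show ?case using F_0 by simp
  next
    case (Suc k)
    obtain j :: 'm where j: "pos j = Suc k" using ex_pos Suc.prems(1) .
    have "x \<in> F k"
    proof (cases "j \<in> jump F h")
      case True
      then show ?thesis using jump_lowers[OF h True, of x] Suc.prems j by simp
    next
      case False
      then have "coord x $ j = 0" using coord_span_on Suc.prems(3) by blast
      then have "coord x $ i = 0" if "k < pos i" for i
        using Suc.prems that j pos_eq_iff[of i j] F_iff_coord[of "Suc k" x] by (cases "i = j") auto
      then show ?thesis using F_iff_coord[of k x] Suc.prems(1) by auto
    qed
    then show ?case using Suc by simp
  qed
  from this[OF order_refl] show ?thesis
    using F_DIM h subspace_span_on by (auto simp: subspace_0)
qed

text \<open>Both components stay at the level of \<open>x\<close>, which will make the adapted basis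
  unipotent. At a jump index the leading part is removed with \<open>V $ j\<close>, at any other
  index with an element of \<open>h\<close>.\<close>

lemma F_decomp:
  assumes h: "subspace h" and "k \<le> DIM('a)" "x \<in> F k"
  shows "\<exists>u\<in>span_on (jump F h) \<inter> F k. \<exists>w\<in>h \<inter> F k. x = u + w"
  using assms(2,3)
proof (induction k arbitrary: x)
  case 0
  then show ?case using F_0 h subspace_span_on by (auto simp: subspace_0)
next
  case (Suc k)
  have sub: "subspace (F (Suc k))" using Suc.prems(1) by (rule subspace_F)
  have mono: "F k \<subseteq> F (Suc k)" using Suc.prems(1) by (intro F_mono) auto
  obtain j :: 'm where j: "pos j = Suc k" using ex_pos Suc.prems(1) .
  show ?case
  proof (cases "j \<in> jump F h")
    case True
    obtain c where c: "x - c *\<^sub>R V $ j \<in> F k"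
      using F_Suc_breakdown[OF Suc.prems(1) _ _ Suc.prems(2), of "V $ j"] V_in_F[of j] j by auto
    then obtain u w where uw: "u \<in> span_on (jump F h) \<inter> F k" "w \<in> h \<inter> F k" "x - c *\<^sub>R V $ j = u + w"
      using Suc.IH[OF _ c] Suc.prems(1) by auto
    have "u + c *\<^sub>R V $ j \<in> span_on (jump F h)"
      using uw(1) True by (intro subspace_add subspace_scale subspace_span_on V_in_span_on) auto
    moreover have "u + c *\<^sub>R V $ j \<in> F (Suc k)"
      using uw(1) mono V_in_F(1)[of j] j sub by (intro subspace_add subspace_scale) auto
    moreover have "x = (u + c *\<^sub>R V $ j) + w" using uw(3) by (simp add: algebra_simps)
    ultimately show ?thesis using uw(2) mono by blast
  next
    case False
    then have "F (Suc k) \<subseteq> h + F k" using j by (simp add: jump_def)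
    then obtain y z where yz: "x = y + z" "y \<in> h" "z \<in> F k"
      using Suc.prems(2) by (meson set_plus_elim subsetD)
    then obtain u w where uw: "u \<in> span_on (jump F h) \<inter> F k" "w \<in> h \<inter> F k" "z = u + w"
      using Suc.IH[of z] Suc.prems(1) by auto
    have "y = x - z" using yz(1) by simp
    then have "y \<in> F (Suc k)" using Suc.prems(2) yz(3) mono sub by (auto intro: subspace_diff)
    then have "y + w \<in> h \<inter> F (Suc k)"
      using yz(2) uw(2) mono h sub by (auto intro: subspace_add)
    moreover have "x = u + (y + w)" using yz(1) uw(3) by (simp add: algebra_simps)
    ultimately show ?thesis using uw(1) mono by blast
  qed
qed

lemma Gr_compl_span_on_jump:
  assumes h: "subspace h"
  shows "h \<in> Gr_compl (span_on (jump F h))"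
proof -
  have "x \<in> span_on (jump F h) + h" for x
    using F_decomp[OF h order_refl, of x] F_DIM by (auto intro: set_plus_intro)
  then show ?thesis
    using h span_on_jump_Int[OF h] by (auto simp: Gr_compl_def)
qed

section \<open>The basis adapted to a complement\<close>

definition adapted_basis :: "'m set \<Rightarrow> 'a set \<Rightarrow> ('a, 'm) vec" where
  "adapted_basis e W = (\<chi> j. if j \<in> e then V $ j else oblique_proj (span_on e) W (V $ j))"

text \<open>For \<open>j\<close> outside the jump set, \<open>V $ j\<close> is an element of
  \<open>h\<close> plus some \<open>z\<close> in the member of the flag below, and the decomposition
  of \<open>z\<close> stays there; projecting removes only its component \<open>u\<close>.\<close>

lemma unipotent_adapted_basis:
  assumes h: "subspace h"
  shows "unipotent (adapted_basis (jump F h) h)"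
  unfolding unipotent_def
proof
  fix j :: 'm
  let ?U = "span_on (jump F h)"
  have k: "pos j - 1 \<le> DIM('a)" using pos_bounds(2)[of j] by simp
  show "adapted_basis (jump F h) h $ j - V $ j \<in> F (pos j - 1)"
  proof (cases "j \<in> jump F h")
    case True
    then show ?thesis using subspace_F[OF k] by (simp add: adapted_basis_def subspace_0)
  next
    case False
    then have "V $ j \<in> h + F (pos j - 1)" using V_in_F(1)[of j] by (auto simp: jump_def)
    then obtain y z where yz: "V $ j = y + z" "y \<in> h" "z \<in> F (pos j - 1)"
      by (rule set_plus_elim)
    obtain u w where uw: "u \<in> ?U \<inter> F (pos j - 1)" "w \<in> h" "z = u + w"
      using F_decomp[OF h k yz(3)] by blast
    have "V $ j = u + (y + w)" using yz uw by (simp add: algebra_simps)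
    then have "oblique_proj ?U h (V $ j) = y + w"
      using oblique_proj_add[OF subspace_span_on Gr_compl_span_on_jump[OF h], of u "y + w"]
        subspace_add[OF h yz(2) uw(2)] uw(1) by simp
    then have "adapted_basis (jump F h) h $ j - V $ j = - u"
      using False yz(1) uw(3) by (simp add: adapted_basis_def)
    then show ?thesis using uw(1) subspace_F[OF k] by (simp add: subspace_neg)
  qed
qed

lemma adapted_basis_in:
  assumes h: "subspace h"
  shows "(\<Sum>j\<in>jump F h. (t $ j) *\<^sub>R (adapted_basis (jump F h) h $ j)) \<in> span_on (jump F h)"
    and "(\<Sum>j\<in>- jump F h. (t $ j) *\<^sub>R (adapted_basis (jump F h) h $ j)) \<in> h"
proof -
  let ?U = "span_on (jump F h)"
  show "(\<Sum>j\<in>jump F h. (t $ j) *\<^sub>R (adapted_basis (jump F h) h $ j)) \<in> ?U"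
    by (intro subspace_sum subspace_scale subspace_span_on) (simp add: adapted_basis_def V_in_span_on)
  have "oblique_proj ?U h x \<in> h" for x
  proof -
    obtain u w where "u \<in> ?U" "w \<in> h" "x = u + w"
      using F_decomp[OF h order_refl, of x] F_DIM by auto
    then show ?thesis
      using oblique_proj_add[OF subspace_span_on Gr_compl_span_on_jump[OF h]] by simp
  qed
  then show "(\<Sum>j\<in>- jump F h. (t $ j) *\<^sub>R (adapted_basis (jump F h) h $ j)) \<in> h"
    by (intro subspace_sum subspace_scale h) (simp add: adapted_basis_def)
qed

text \<open>The coordinates in \<open>V\<close> serve for both vectors. Those of \<open>x\<close>
  vanish outside the jump set. For \<open>y\<close>, projecting its expansion onto \<open>h\<close>
  fixes \<open>y\<close> and kills the terms with \<open>j\<close> in the jump set.\<close>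

lemma adapted_basis_coords:
  assumes h: "subspace h" and x: "x \<in> span_on (jump F h)" and y: "y \<in> h"
  obtains t where "x = (\<Sum>j\<in>jump F h. (t $ j) *\<^sub>R (adapted_basis (jump F h) h $ j))"
    "y = (\<Sum>j\<in>- jump F h. (t $ j) *\<^sub>R (adapted_basis (jump F h) h $ j))"
proof
  let ?e = "jump F h"
  let ?Q = "oblique_proj (span_on ?e) h"
  let ?t = "\<chi> j. if j \<in> ?e then coord x $ j else coord y $ j"
  note Gr = subspace_span_on Gr_compl_span_on_jump[OF h]
  have "x = (\<Sum>j\<in>UNIV. (coord x $ j) *\<^sub>R (V $ j))"
    using lincomb_coord[of x] by (simp add: lincomb_def)
  also have "\<dots> = (\<Sum>j\<in>?e. (coord x $ j) *\<^sub>R (V $ j))"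
    using coord_span_on[OF x] by (intro sum.mono_neutral_right) auto
  finally show "x = (\<Sum>j\<in>?e. (?t $ j) *\<^sub>R (adapted_basis ?e h $ j))"
    by (simp add: adapted_basis_def)
  have "y = ?Q y"
    using oblique_proj_add[OF Gr subspace_0[OF subspace_span_on] y] by simp
  also have "\<dots> = ?Q (\<Sum>j\<in>UNIV. (coord y $ j) *\<^sub>R (V $ j))"
    using lincomb_coord[of y] by (simp add: lincomb_def)
  also have "\<dots> = (\<Sum>j\<in>UNIV. (coord y $ j) *\<^sub>R ?Q (V $ j))"
    by (simp add: linear_sum[OF linear_oblique_proj[OF Gr]] linear_scale[OF linear_oblique_proj[OF Gr]])
  also have "\<dots> = (\<Sum>j\<in>- ?e. (coord y $ j) *\<^sub>R ?Q (V $ j))"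
  proof (rule sum.mono_neutral_right)
    show "\<forall>j\<in>UNIV - - ?e. (coord y $ j) *\<^sub>R ?Q (V $ j) = 0"
      using oblique_proj_add[OF Gr V_in_span_on subspace_0[OF h]] by simp
  qed auto
  finally show "y = (\<Sum>j\<in>- ?e. (?t $ j) *\<^sub>R (adapted_basis ?e h $ j))"
    by (simp add: adapted_basis_def)
qed

section \<open>The inverse of the multiplication map\<close>

definition bch_split :: "'m set \<Rightarrow> 'a set \<Rightarrow> 'a \<Rightarrow> 'a \<times> 'a" where
  "bch_split e h X =
     (\<Sum>j\<in>e. (bch_solve e X (adapted_basis e h) $ j) *\<^sub>R (adapted_basis e h $ j),
      \<Sum>j\<in>- e. (bch_solve e X (adapted_basis e h) $ j) *\<^sub>R (adapted_basis e h $ j))"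

lemma bch_split_in:
  assumes "subspace h" "e = jump F h"
  shows "bch_split e h X \<in> span_on e \<times> h"
  unfolding bch_split_def using adapted_basis_in[OF assms(1)] assms(2) by simp

text \<open>In the coordinates of the adapted basis this is \<open>bch_coord_eq_iff\<close>. The
  equivalence carries both existence and uniqueness of the factorization, for the diffeomorphism and
  for the function in (ii).\<close>

lemma bch_eq_iff_bch_split:
  assumes "subspace h" "e = jump F h" "x \<in> span_on e" "y \<in> h"
  shows "bch br x y = X \<longleftrightarrow> (x, y) = bch_split e h X"
proof
  have B: "unipotent (adapted_basis e h)"
    using unipotent_adapted_basis assms by simp
  {
    assume "bch br x y = X"
    moreover obtain t where t: "x = (\<Sum>j\<in>e. (t $ j) *\<^sub>R (adapted_basis e h $ j))"
      "y = (\<Sum>j\<in>- e. (t $ j) *\<^sub>R (adapted_basis e h $ j))"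
      using adapted_basis_coords[OF assms(1)] assms by metis
    ultimately have "bch_coord e (adapted_basis e h) t = X"
      by (simp add: bch_coord_def)
    then show "(x, y) = bch_split e h X"
      using bch_coord_eq_iff[OF B] t by (simp add: bch_split_def)
  next
    assume "(x, y) = bch_split e h X"
    then have "bch br x y = bch_coord e (adapted_basis e h) (bch_solve e X (adapted_basis e h))"
      by (simp add: bch_split_def bch_coord_def)
    then show "bch br x y = X"
      using bch_coord_eq_iff[OF B, of e "bch_solve e X (adapted_basis e h)" X] by simp
  }
qed

lemma polynomial_function_bch_split: "polynomial_function (bch_split e h)"
proof -
  have "polynomial_function (\<lambda>X. (X, adapted_basis e h))"
    by (intro polynomial_function_Pair) auto
  from polynomial_function_compose[OF this polynomial_function_bch_solve]
  have "polynomial_function (\<lambda>X. bch_solve e X (adapted_basis e h) $ j)" for j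
    by (intro polynomial_function_vec_nth) (simp add: o_def)
  then show ?thesis
    unfolding bch_split_def[abs_def]
    by (intro polynomial_function_Pair polynomial_function_sum polynomial_function_mult) auto
qed

lemma polynomial_diffeo_bch:
  assumes "subspace h" "e = jump F h"
  shows "polynomial_diffeo (span_on e \<times> h) UNIV (\<lambda>(X, Y). bch br X Y)"
proof -
  let ?f = "\<lambda>(X, Y). bch br X Y"
  have left: "bch_split e h (?f s) = s" if "s \<in> span_on e \<times> h" for s
    using that bch_eq_iff_bch_split[OF assms, of "fst s" "snd s" "?f s"] by auto
  have right: "?f (bch_split e h X) = X" for X
    using bch_split_in[OF assms, of X] bch_eq_iff_bch_split[OF assms, of "fst (bch_split e h X)" "snd (bch_split e h X)" X]
    by (auto simp: split_def)
  have bij: "bij_betw ?f (span_on e \<times> h) UNIV"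
  proof (rule bij_betw_byWitness[where f' = "bch_split e h"])
    show "bch_split e h ` UNIV \<subseteq> span_on e \<times> h"
      using bch_split_in[OF assms] by blast
  qed (use left right in auto)
  moreover have "polynomial_map_on (span_on e \<times> h) ?f"
  proof -
    have "polynomial_function (\<lambda>z. bch br (fst z) (snd z))"
      by (intro polynomial_function_bch polynomial_function_bounded_linear
          bounded_linear_fst bounded_linear_snd)
    then show ?thesis
      unfolding polynomial_map_on_def by (auto simp: split_def)
  qed
  moreover have "inv_into (span_on e \<times> h) ?f X = bch_split e h X" for X
    using bij bch_split_in[OF assms] right
    by (intro inv_into_f_eq) (auto simp: bij_betw_def)
  then have "polynomial_map_on UNIV (inv_into (span_on e \<times> h) ?f)"
    using polynomial_function_bch_split unfolding polynomial_map_on_def by metis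
  ultimately show ?thesis by (simp add: polynomial_diffeo_def)
qed

end

theorem theorem5p3:
  fixes br :: "'a::euclidean_space \<Rightarrow> 'a \<Rightarrow> 'a"
    and F :: "nat \<Rightarrow> 'a set"
    and V :: "'a ^ 'm::{finite,linorder}"
    and e :: "'m set"
    and ge :: "'a set"
  assumes "nilpotent_lie_algebra br"
    and "CARD('m) = DIM('a)"
    and "jh_sequence br F"
    and "V \<in> JH F"
    and "ge = span {V $ j | j. j \<in> e}"
  shows "(\<forall>h\<in>Gr_alg br F e. polynomial_diffeo (ge \<times> h) UNIV (\<lambda>(X, Y). bch br X Y)) \<and>
    (\<exists>(\<beta> :: 'a set \<Rightarrow> ('a, 'm) vec) (p :: 'a \<times> ('a, 'm) vec \<Rightarrow> (real, 'm) vec).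
       Gr_analytic_on (Gr_compl ge) \<beta> \<and>
       polynomial_map_on (UNIV \<times> JH F) p \<and>
       (\<forall>h\<in>Gr_alg br F e. \<beta> h \<in> JH F) \<and>
       (let \<pi> = (\<lambda>Y h. \<Sum>j\<in>e. (p (Y, \<beta> h) $ j) *\<^sub>R (\<beta> h $ j));
            good = (\<lambda>\<Phi>. (\<forall>X. \<forall>h\<in>Gr_alg br F e. \<Phi> X h \<in> ge) \<and>
                         (\<forall>X. \<forall>h\<in>Gr_alg br F e. X \<in> {bch br (\<Phi> X h) H | H. H \<in> h}))
        in good \<pi> \<and>
           (\<forall>\<Phi>. good \<Phi> \<longrightarrow> (\<forall>X. \<forall>h\<in>Gr_alg br F e. \<Phi> X h = \<pi> X h))))"
proof -
  interpret jh_basis br F V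
    using assms by unfold_locales (auto simp: nilpotent_lie_algebra_def lie_bracket_def)
  have ge: "ge = span_on e"
    using assms(5) by (simp add: span_on_def)
  have h: "subspace h" "e = jump F h" if "h \<in> Gr_alg br F e" for h
    using that by (auto simp: Gr_alg_def lie_subalgebra_def)
  \<comment> \<open>The subalgebra enters \<open>?p\<close> only through the basis.
    \<open>?p\<close> is one polynomial map of a vector and an arbitrary tuple, and it solves the
    equation when the tuple is unipotent, as \<open>?\<beta> h\<close> is for \<open>h\<close> in
    \<open>Gr_alg br F e\<close>.\<close>
  let ?\<beta> = "adapted_basis e" and ?p = "\<lambda>z. bch_solve e (fst z) (snd z)"
  let ?\<pi> = "\<lambda>Y h. \<Sum>j\<in>e. (?p (Y, ?\<beta> h) $ j) *\<^sub>R (?\<beta> h $ j)"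
  have \<pi>: "?\<pi> X h = fst (bch_split e h X)" for X h
    by (simp add: bch_split_def)
  have "Gr_analytic_on (Gr_compl ge) ?\<beta>"
    unfolding adapted_basis_def[abs_def] ge by (rule Gr_analytic_on_oblique_proj[OF subspace_span_on])
  moreover have "polynomial_map_on (UNIV \<times> JH F) ?p"
    using polynomial_function_bch_solve unfolding polynomial_map_on_def by blast
  moreover have "?\<beta> h \<in> JH F" if "h \<in> Gr_alg br F e" for h
    using unipotent_in_JH unipotent_adapted_basis h[OF that] by simp
  moreover have "?\<pi> X h \<in> ge \<and> X \<in> {bch br (?\<pi> X h) H | H. H \<in> h}"
    if "h \<in> Gr_alg br F e" for X h
  proof -
    obtain x y where xy: "bch_split e h X = (x, y)" by fastforce
    then have "x \<in> span_on e" "y \<in> h" using bch_split_in[OF h[OF that], of X] by auto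
    moreover have "bch br x y = X"
      using bch_eq_iff_bch_split[OF h[OF that] calculation] xy by simp
    ultimately show ?thesis unfolding \<pi> xy ge by auto
  qed
  moreover have "\<Phi> X h = ?\<pi> X h"
    if \<Phi>: "\<forall>X. \<forall>h\<in>Gr_alg br F e. \<Phi> X h \<in> ge"
      "\<forall>X. \<forall>h\<in>Gr_alg br F e. X \<in> {bch br (\<Phi> X h) H | H. H \<in> h}" and hGr: "h \<in> Gr_alg br F e" for \<Phi> X h
  proof -
    \<comment> \<open>A competing function supplies its own factorization of \<open>X\<close>; by
      uniqueness its left factor is that of \<open>bch_split\<close>.\<close>
    obtain H where "X = bch br (\<Phi> X h) H" "H \<in> h" "\<Phi> X h \<in> span_on e"
      using \<Phi>(1) \<Phi>(2)[rule_format, OF hGr, of X] hGr unfolding ge by auto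
    then have "(\<Phi> X h, H) = bch_split e h X"
      using bch_eq_iff_bch_split[OF h[OF hGr]] by metis
    then show ?thesis unfolding \<pi> by (metis fst_conv)
  qed
  moreover have "polynomial_diffeo (ge \<times> h) UNIV (\<lambda>(X, Y). bch br X Y)"
    if "h \<in> Gr_alg br F e" for h
    using polynomial_diffeo_bch[OF h[OF that]] unfolding ge .
  ultimately show ?thesis
    unfolding Let_def by (intro conjI ballI exI[of _ ?\<beta>] exI[of _ ?p] allI impI) blast+
qed

end
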